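(* Let $A$ be a finite alphabet, let $d\in\mathbb N$, $V=\{1,\dots,d\}$, and let $\{X^{(i)}\colon i\in\mathbb N\}$ be a stationary stochastic process with values in $A^d$ whose one-dimensional marginal distribution $\pi$ (the law of $X^{(1)}$ on $A^d$) satisfies the Markov intersection property. Let $G^*$ be the graph on $V$ of conditional dependencies of $\pi$. Assume that the process satisfies the mixing condition with rate $\psi(\ell)=O(1/\ell^{1+\epsilon})$ for some $\epsilon>0$. Then, taking $\lambda_n=c\log n$ with $c>0$, the graph estimator $$\widehat G\;=\;\underset{G}{\arg\max}\Bigl\{\log\widehat L(G)-\lambda_n\sum_{v\in V}|A|^{|G(v)|}\Bigr\},$$ the maximum being over all simple undirected graphs $G$ on the vertex set $V$, where $\widehat L(G)$ is the maximum pseudo-likelihood of $G$ computed from the sample $X^{(1)},\dots,X^{(n)}$, satisfies $\widehat G=G^*$ eventually almost surely as $n\to\infty$; that is, with probability one, $\widehat G=G^*$ for all $n$ large enough.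
   Context: Mixing condition: the process $\{X^{(i)}\}_{i\in\mathbb N}$ with values in $A^d$ satisfies the mixing condition with rate $\{\psi(\ell)\}_{\ell\in\mathbb N}$ if for all $k,m,\ell,n\in\mathbb N$ with $n\ge m+\ell$, all $(y^{(1)},\dots,y^{(k)})\in (A^d)^k$ and all $(x^{(1)},\dots,x^{(m)})\in (A^d)^m$ with $\mathbb P(X^{(1:m)}=x^{(1:m)})>0$, $$\bigl|\mathbb P(X^{(n:(n+k-1))}=y^{(1:k)}\mid X^{(1:m)}=x^{(1:m)})-\mathbb P(X^{(n:(n+k-1))}=y^{(1:k)})\bigr|\le\psi(\ell)\,\mathbb P(X^{(n:(n+k-1))}=y^{(1:k)}),$$ where $X^{(i:j)}=(X^{(i)},\dots,X^{(j)})$, and similarly for lower-case sequences. Notation: for $W\subset V$ and $a_W\in A^W$, $\pi(a_W)=\mathbb P(X^{(1)}_W=a_W)$, where $X_W^{(i)}=(X^{(i)}_u)_{u\in W}$; if $\pi(a_W)>0$, $\pi(a_U\mid a_W)=\mathbb P(X^{(1)}_U=a_U\mid X^{(1)}_W=a_W)$. Markov neighborhoods: for $v\in V$, a set $W\subset V\setminus\{v\}$ is a Markov neighborhood of $v$ if for all $U$ with $W\subset U\subset V\setminus\{v\}$, all $a_v\in A$ and all $a_U\in A^U$ with $\pi(a_U)>0$ one has $\pi(a_v\mid a_U)=\pi(a_v\mid a_W)$, where $a_W$ is the restriction of $a_U$ to $W$. The Markov intersection property for $\pi$: for all $v\in V$ and all Markov neighborhoods $W_1,W_2$ of $v$, $W_1\cap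 W_2$ is also a Markov neighborhood of $v$. The basic neighborhood $\mathrm{ne}(v)$ of $v$ is the intersection of all Markov neighborhoods of $v$. The graph of conditional dependencies is $G^*=(V,E^* )$ with $(v,w)\in E^*$ if and only if $w\in\mathrm{ne}(v)$ (this is a simple undirected graph). Estimation: for a simple undirected graph $G=(V,E)$ and $v\in V$, $G(v)=\{u\in V\colon(u,v)\in E\}$, and $|G(v)|$ is its cardinality. For $W\subset V$ and $a_W\in A^W$, $N(a_W)$ is the number of indices $i\in\{1,\dots,n\}$ with $X^{(i)}_W=a_W$, and $\widehat\pi(a_W)=N(a_W)/n$. For disjoint $W,W'\subset V$ with $\widehat\pi(a_{W'})>0$, $\widehat\pi(a_W\mid a_{W'})=\widehat\pi(a_{W\cup W'})/\widehat\pi(a_{W'})$. The maximum pseudo-likelihood is $$\widehat L(G)=\prod_{i=1}^n\prod_{v\in V}\widehat\pi\bigl(X^{(i)}_v\mid X^{(i)}_{G(v)}\bigr),$$ equivalently $\log\widehat L(G)=\sum_{v\in V}\sum_{a_v,a_{G(v)}}N(a_v,a_{G(v)})\log\widehat\pi(a_v\mid a_{G(v)})$, the sum being over $a_v\in A$, $a_{G(v)}\in A^{G(v)}$ with $N(a_v,a_{G(v)})>0$.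
   Formalization: The alphabet A is assumed to have at least two letters; for a one-letter alphabet and d ≥ 2 all graphs have the same penalized score, so the argmax is not unique and the claim fails. *)

theory Defs
  imports "HOL-Probability.Probability" "HOL-Library.Landau_Symbols"
begin

text \<open>
  Configurations on a finite set \<open>W\<close> of sites over the alphabet \<open>A\<close> are the
  extensional functions in \<open>W \<rightarrow>\<^sub>E A\<close>, and \<open>restrict x W\<close> is the
  subconfiguration \<open>x\<^sub>W\<close>. Processes and samples are indexed by the positive
  integers: the value at index \<open>0\<close> is never constrained and never used.
\<close>

abbreviation config_space :: "nat set \<Rightarrow> 'a set \<Rightarrow> (nat \<Rightarrow> 'a) measure" where
  "config_space V A \<equiv> count_space (V \<rightarrow>\<^sub>E A)"

text \<open>The block \<open>X\<^sup>(\<^sup>i\<^sup>:\<^sup>j\<^sup>)\<close>, as the list of its entries.\<close>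

definition block :: "(nat \<Rightarrow> 'w \<Rightarrow> 'c) \<Rightarrow> nat \<Rightarrow> nat \<Rightarrow> 'w \<Rightarrow> 'c list" where
  "block X i j \<omega> = map (\<lambda>t. X t \<omega>) [i..<Suc j]"

definition stationary_process :: "'w measure \<Rightarrow> 'c set \<Rightarrow> (nat \<Rightarrow> 'w \<Rightarrow> 'c) \<Rightarrow> bool" where
  "stationary_process M S X \<longleftrightarrow>
     (\<forall>k\<ge>1. \<forall>i. \<forall>y. length y = k \<and> set y \<subseteq> S \<longrightarrow>
        \<P>(\<omega> in M. block X (i + 1) (i + k) \<omega> = y) = \<P>(\<omega> in M. block X 1 k \<omega> = y))"

definition mixing_with_rate ::
  "'w measure \<Rightarrow> 'c set \<Rightarrow> (nat \<Rightarrow> 'w \<Rightarrow> 'c) \<Rightarrow> (nat \<Rightarrow> real) \<Rightarrow> bool" where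
  "mixing_with_rate M S X \<psi> \<longleftrightarrow>
     (\<forall>k\<ge>1. \<forall>m\<ge>1. \<forall>l\<ge>1. \<forall>n\<ge>m + l. \<forall>y x.
        length y = k \<and> set y \<subseteq> S \<and> length x = m \<and> set x \<subseteq> S \<and>
        \<P>(\<omega> in M. block X 1 m \<omega> = x) > 0 \<longrightarrow>
        \<bar>\<P>(\<omega> in M. block X n (n + k - 1) \<omega> = y \<bar> block X 1 m \<omega> = x)
           - \<P>(\<omega> in M. block X n (n + k - 1) \<omega> = y)\<bar>
          \<le> \<psi> l * \<P>(\<omega> in M. block X n (n + k - 1) \<omega> = y))"

text \<open>Below, \<open>\<pi>\<close> is a probability measure on \<open>V \<rightarrow>\<^sub>E A\<close>.\<close>

definition markov_neighborhood ::
  "nat set \<Rightarrow> 'a set \<Rightarrow> (nat \<Rightarrow> 'a) measure \<Rightarrow> nat \<Rightarrow> nat set \<Rightarrow> bool" where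
  "markov_neighborhood V A \<pi> v W \<longleftrightarrow>
     W \<subseteq> V - {v} \<and>
     (\<forall>U. W \<subseteq> U \<and> U \<subseteq> V - {v} \<longrightarrow>
        (\<forall>a\<in>A. \<forall>b\<in>U \<rightarrow>\<^sub>E A. \<P>(x in \<pi>. restrict x U = b) > 0 \<longrightarrow>
           \<P>(x in \<pi>. x v = a \<bar> restrict x U = b) =
           \<P>(x in \<pi>. x v = a \<bar> restrict x W = restrict b W)))"

definition markov_intersection_property ::
  "nat set \<Rightarrow> 'a set \<Rightarrow> (nat \<Rightarrow> 'a) measure \<Rightarrow> bool" where
  "markov_intersection_property V A \<pi> \<longleftrightarrow>
     (\<forall>v\<in>V. \<forall>W1 W2. markov_neighborhood V A \<pi> v W1 \<and> markov_neighborhood V A \<pi> v W2 \<longrightarrow>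
        markov_neighborhood V A \<pi> v (W1 \<inter> W2))"

text \<open>The intersection is over a nonempty family, since \<open>V - {v}\<close> is a Markov neighborhood.\<close>

definition basic_neighborhood ::
  "nat set \<Rightarrow> 'a set \<Rightarrow> (nat \<Rightarrow> 'a) measure \<Rightarrow> nat \<Rightarrow> nat set" where
  "basic_neighborhood V A \<pi> v = \<Inter> {W. markov_neighborhood V A \<pi> v W}"

text \<open>Graphs on \<open>V\<close> are given by their edge relation, an undirected edge being
  represented by both of its orientations.\<close>

definition simple_graph :: "nat set \<Rightarrow> (nat \<times> nat) set \<Rightarrow> bool" where
  "simple_graph V E \<longleftrightarrow> E \<subseteq> V \<times> V \<and> sym E \<and> irrefl E"

definition nbrs :: "nat set \<Rightarrow> (nat \<times> nat) set \<Rightarrow> nat \<Rightarrow> nat set" where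
  "nbrs V E v = {u \<in> V. (u, v) \<in> E}"

definition dependency_graph ::
  "nat set \<Rightarrow> 'a set \<Rightarrow> (nat \<Rightarrow> 'a) measure \<Rightarrow> (nat \<times> nat) set" where
  "dependency_graph V A \<pi> = {(v, w) \<in> V \<times> V. w \<in> basic_neighborhood V A \<pi> v}"

text \<open>In the following, \<open>x 1, \<dots>, x n\<close> is the observed sample.\<close>

definition emp_count :: "(nat \<Rightarrow> nat \<Rightarrow> 'a) \<Rightarrow> nat \<Rightarrow> nat set \<Rightarrow> (nat \<Rightarrow> 'a) \<Rightarrow> nat" where
  "emp_count x n W a = card {i \<in> {1..n}. restrict (x i) W = a}"

definition emp_prob :: "(nat \<Rightarrow> nat \<Rightarrow> 'a) \<Rightarrow> nat \<Rightarrow> nat set \<Rightarrow> (nat \<Rightarrow> 'a) \<Rightarrow> real" where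
  "emp_prob x n W a = real (emp_count x n W a) / real n"

text \<open>The empirical conditional probability of \<open>a\<^sub>W\<close> given \<open>a\<^sub>W\<^sub>'\<close>, where \<open>a\<close> is any
  configuration defined on at least \<open>W \<union> W'\<close>.\<close>

definition emp_cond_prob ::
  "(nat \<Rightarrow> nat \<Rightarrow> 'a) \<Rightarrow> nat \<Rightarrow> nat set \<Rightarrow> nat set \<Rightarrow> (nat \<Rightarrow> 'a) \<Rightarrow> real" where
  "emp_cond_prob x n W W' a =
     emp_prob x n (W \<union> W') (restrict a (W \<union> W')) / emp_prob x n W' (restrict a W')"

definition max_pseudo_likelihood ::
  "nat set \<Rightarrow> (nat \<Rightarrow> nat \<Rightarrow> 'a) \<Rightarrow> nat \<Rightarrow> (nat \<times> nat) set \<Rightarrow> real" where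
  "max_pseudo_likelihood V x n G =
     (\<Prod>i\<in>{1..n}. \<Prod>v\<in>V. emp_cond_prob x n {v} (nbrs V G v) (x i))"

definition penalized_score ::
  "nat set \<Rightarrow> 'a set \<Rightarrow> real \<Rightarrow> (nat \<Rightarrow> nat \<Rightarrow> 'a) \<Rightarrow> nat \<Rightarrow> (nat \<times> nat) set \<Rightarrow> real" where
  "penalized_score V A lam x n G =
     ln (max_pseudo_likelihood V x n G) - lam * (\<Sum>v\<in>V. real (card A ^ card (nbrs V G v)))"

text \<open>\<open>is_graph_estimate V A lam x n G\<close> says that \<open>G\<close> attains the maximum; the maximizer
  need not be unique for a given sample.\<close>

definition is_graph_estimate ::
  "nat set \<Rightarrow> 'a set \<Rightarrow> real \<Rightarrow> (nat \<Rightarrow> nat \<Rightarrow> 'a) \<Rightarrow> nat \<Rightarrow> (nat \<times> nat) set \<Rightarrow> bool" where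
  "is_graph_estimate V A lam x n G \<longleftrightarrow>
     is_arg_max (penalized_score V A lam x n) (simple_graph V) G"

end

theory Submission
  imports Defs "HOL-Real_Asymp.Real_Asymp"
begin

text \<open>
  By \<open>\<psi>\<close>-mixing with summable rate, the centred indicators \<open>1{X\<^sup>(\<^sup>i\<^sup>) = y} - \<pi>(y)\<close> have partial sums
  with fourth moments of order \<open>n\<^sup>2\<close>. A dyadic maximal inequality and summability over the scales \<open>2\<^sup>k\<close> then give
  \<open>(N(y) - n \<pi>(y))\<^sup>2 = o(n log n)\<close> almost surely, which is just what the penalty \<open>c log n\<close> needs,
  for every \<open>c > 0\<close>.

  The penalized pseudo-likelihood is a sum over the sites \<open>v\<close> of a score of the candidate
  neighborhood \<open>G(v)\<close>. The log-likelihood of a neighborhood \<open>W\<close> is the empirical mean of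
  \<open>log \<pi>(x\<^sub>v | x\<^sub>W)\<close> plus a difference of two relative entropies, each bounded by a \<open>\<chi>\<^sup>2\<close> statistic and
  hence \<open>o(log n)\<close>. If \<open>W\<close> is a Markov neighborhood, \<open>\<pi>(x\<^sub>v | x\<^sub>W)\<close> is the same as for the
  basic neighborhood, and the penalty decides; if not, Gibbs' inequality is strict and \<open>W\<close> loses by
  a term of order \<open>n\<close>. The intersection property makes the basic neighborhoods Markov and the
  dependency graph symmetric, so that choosing the best neighborhood at each site separately yields
  a graph.
\<close>

section \<open>Partial sums of weakly dependent variables\<close>

text \<open>A weighted convexity bound: the coefficient of \<open>b ^ 4\<close> is pushed below 2 at
  the price of a large coefficient of \<open>a ^ 4\<close>.\<close>

lemma power4_add_le:
  fixes a b :: real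
  shows "(a + b) ^ 4 \<le> 1764 * a ^ 4 + 3 / 2 * b ^ 4"
proof -
  have sq: "(x + y)\<^sup>2 \<le> (1 + t) * x\<^sup>2 + (1 + 1 / t) * y\<^sup>2" if "t > 0" for x y t :: real
  proof -
    have "0 \<le> (t * x - y)\<^sup>2 / t" using that by simp
    also have "\<dots> = t * x\<^sup>2 - 2 * x * y + y\<^sup>2 / t"
      using that by (simp add: field_simps power2_eq_square)
    finally show ?thesis by (simp add: power2_eq_square algebra_simps)
  qed
  have "(a + b) ^ 4 = ((a + b)\<^sup>2)\<^sup>2" by (simp add: power_mult [symmetric])
  \<comment> \<open>The weighted square inequality is applied with weight 20 and then with weight 3,
    so that \<open>4 * 21^2 = 1764\<close> and \<open>4/3 * (21/20)^2 = 1.47\<close>.\<close>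
  also have "\<dots> \<le> (21 * a\<^sup>2 + (1 + 1 / 20) * b\<^sup>2)\<^sup>2"
    using sq [of 20 a b] by (intro power_mono) auto
  also have "\<dots> \<le> (1 + 3) * (21 * a\<^sup>2)\<^sup>2 + (1 + 1 / 3) * ((1 + 1 / 20) * b\<^sup>2)\<^sup>2"
    by (rule sq) simp
  also have "\<dots> \<le> 1764 * a ^ 4 + 3 / 2 * b ^ 4"
    by (simp add: power_mult_distrib power_divide)
  finally show ?thesis .
qed

text \<open>The weak dependence condition is what a \<open>\<psi>\<close>-mixing condition with summable rate gives for
  centred bounded functions of single coordinates.\<close>

locale weakly_dependent = prob_space M for M :: "'w measure" +
  fixes Y :: "nat \<Rightarrow> 'w \<Rightarrow> real" and \<rho> :: "nat \<Rightarrow> real"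
  assumes Y_measurable [measurable]: "\<And>i. Y i \<in> borel_measurable M"
    and Y_bounded: "\<And>i \<omega>. \<omega> \<in> space M \<Longrightarrow> \<bar>Y i \<omega>\<bar> \<le> 1"
    and \<rho>_nonneg: "\<And>l. 0 \<le> \<rho> l"
    and \<rho>_summable: "summable \<rho>"
    and weak_dependence:
      "\<And>i k g. i < k \<Longrightarrow> g \<in> borel_measurable M \<Longrightarrow>
        (\<And>\<omega> \<omega>'. \<omega> \<in> space M \<Longrightarrow> \<omega>' \<in> space M \<Longrightarrow> (\<forall>j\<le>i. Y j \<omega> = Y j \<omega>') \<Longrightarrow> g \<omega> = g \<omega>') \<Longrightarrow>
        \<bar>expectation (\<lambda>\<omega>. Y k \<omega> * g \<omega>)\<bar> \<le> \<rho> (k - i) * expectation (\<lambda>\<omega>. \<bar>g \<omega>\<bar>)"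
begin

section \<open>Moment bounds for partial sums\<close>

definition S :: "nat \<Rightarrow> nat \<Rightarrow> 'w \<Rightarrow> real" where
  "S s n \<omega> = (\<Sum>i<n. Y (s + i) \<omega>)"

lemma S_0 [simp]: "S s 0 \<omega> = 0" by (simp add: S_def)
lemma S_Suc: "S s (Suc n) \<omega> = S s n \<omega> + Y (s + n) \<omega>" by (simp add: S_def)

lemma S_add: "S s (m + n) \<omega> = S s m \<omega> + S (s + m) n \<omega>"
  by (induction n) (simp_all add: S_Suc add.assoc)

lemma S_measurable [measurable]: "S s n \<in> borel_measurable M"
  unfolding S_def by measurable

lemma S_bounded: "\<omega> \<in> space M \<Longrightarrow> \<bar>S s n \<omega>\<bar> \<le> real n"
proof (induction n)
  case (Suc n)
  then show ?case using Y_bounded[of \<omega> "s + n"] by (simp add: S_Suc)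
qed simp

lemma integrable_bounded:
  assumes "f \<in> borel_measurable M" "\<And>\<omega>. \<omega> \<in> space M \<Longrightarrow> \<bar>f \<omega>\<bar> \<le> B"
  shows "integrable M (f :: 'w \<Rightarrow> real)"
  using assms by (intro integrable_const_bound[of _ B]) auto

lemma integrable_S_power: "integrable M (\<lambda>\<omega>. S s n \<omega> ^ p)"
  by (rule integrable_bounded[of _ "real n ^ p"])
    (auto simp: power_abs intro!: power_mono S_bounded)

lemma integrable_Y_mult:
  assumes "integrable M f"
  shows "integrable M (\<lambda>\<omega>. Y i \<omega> * f \<omega>)"
proof (rule Bochner_Integration.integrable_bound[OF assms])
  show "(\<lambda>\<omega>. Y i \<omega> * f \<omega>) \<in> borel_measurable M" using assms by measurable
  show "AE \<omega> in M. norm (Y i \<omega> * f \<omega>) \<le> norm (f \<omega>)"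
    using Y_bounded by (auto simp: abs_mult intro!: mult_left_le_one_le)
qed

lemma sum_\<rho>_le: "(\<Sum>i<n. \<rho> (n - i)) \<le> suminf \<rho>"
proof -
  have "(\<Sum>i<n. \<rho> (n - i)) = sum \<rho> {1..n}"
    by (rule sum.reindex_bij_witness[of _ "\<lambda>i. n - i" "\<lambda>i. n - i"]) auto
  also have "\<dots> \<le> suminf \<rho>"
    using \<rho>_summable by (intro sum_le_suminf) (auto simp: \<rho>_nonneg)
  finally show ?thesis .
qed

text \<open>Telescoping \<open>S\<^sup>p\<close> along its length, each increment is a function of a past at
  a known distance from \<open>Y\<^sub>s\<^sub>+\<^sub>n\<close>.\<close>

lemma Y_mult_S_power_bound:
  assumes "0 < p" and "\<And>i. i < n \<Longrightarrow> expectation (\<lambda>\<omega>. \<bar>S s (Suc i) \<omega> ^ p - S s i \<omega> ^ p\<bar>) \<le> D"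
    and "0 \<le> D"
  shows "\<bar>expectation (\<lambda>\<omega>. Y (s + n) \<omega> * S s n \<omega> ^ p)\<bar> \<le> suminf \<rho> * D"
proof -
  let ?g = "\<lambda>i \<omega>. S s (Suc i) \<omega> ^ p - S s i \<omega> ^ p"
  have int: "integrable M (?g i)" for i
    by (intro Bochner_Integration.integrable_diff integrable_S_power)
  have "S s n \<omega> ^ p = (\<Sum>i<n. ?g i \<omega>)" for \<omega>
    using assms(1) by (subst sum_lessThan_telescope) simp
  then have "expectation (\<lambda>\<omega>. Y (s + n) \<omega> * S s n \<omega> ^ p)
      = expectation (\<lambda>\<omega>. \<Sum>i<n. Y (s + n) \<omega> * ?g i \<omega>)"
    by (simp only: sum_distrib_left)
  also have "\<dots> = (\<Sum>i<n. expectation (\<lambda>\<omega>. Y (s + n) \<omega> * ?g i \<omega>))"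
    by (intro Bochner_Integration.integral_sum integrable_Y_mult int)
  finally have "\<bar>expectation (\<lambda>\<omega>. Y (s + n) \<omega> * S s n \<omega> ^ p)\<bar>
      \<le> (\<Sum>i<n. \<bar>expectation (\<lambda>\<omega>. Y (s + n) \<omega> * ?g i \<omega>)\<bar>)"
    by simp
  also have "\<dots> \<le> (\<Sum>i<n. \<rho> (n - i) * D)"
  proof (rule sum_mono)
    fix i assume i: "i \<in> {..<n}"
    have "\<bar>expectation (\<lambda>\<omega>. Y (s + n) \<omega> * ?g i \<omega>)\<bar> \<le> \<rho> (s + n - (s + i)) * expectation (\<lambda>\<omega>. \<bar>?g i \<omega>\<bar>)"
      using i by (intro weak_dependence) (auto simp: S_def)
    also have "\<dots> \<le> \<rho> (n - i) * D"
      using assms(2)[of i] i \<rho>_nonneg by (simp add: mult_left_mono)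
    finally show "\<bar>expectation (\<lambda>\<omega>. Y (s + n) \<omega> * ?g i \<omega>)\<bar> \<le> \<rho> (n - i) * D" .
  qed
  also have "\<dots> = (\<Sum>i<n. \<rho> (n - i)) * D" by (simp add: sum_distrib_right)
  also have "\<dots> \<le> suminf \<rho> * D" by (intro mult_right_mono sum_\<rho>_le assms)
  finally show ?thesis .
qed

lemma Y_power_le_1: "\<omega> \<in> space M \<Longrightarrow> Y i \<omega> ^ p \<le> 1" "\<omega> \<in> space M \<Longrightarrow> \<bar>Y i \<omega> ^ p\<bar> \<le> 1"
proof -
  assume "\<omega> \<in> space M"
  then show "\<bar>Y i \<omega> ^ p\<bar> \<le> 1" using Y_bounded by (simp add: power_abs power_le_one)
  then show "Y i \<omega> ^ p \<le> 1" by linarith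
qed

text \<open>Each new summand adds \<open>2 * Y * S + Y^2\<close>. The cross term has bounded
  expectation by \<open>Y_mult_S_power_bound\<close>, since the increments of \<open>S\<close> are
  bounded by 1; hence linear growth.\<close>

lemma second_moment: "expectation (\<lambda>\<omega>. S s n \<omega> ^ 2) \<le> (2 * suminf \<rho> + 1) * real n"
proof (induction n)
  case (Suc n)
  have a: "\<bar>expectation (\<lambda>\<omega>. Y (s + n) \<omega> * S s n \<omega> ^ 1)\<bar> \<le> suminf \<rho> * 1"
  proof (rule Y_mult_S_power_bound)
    show "expectation (\<lambda>\<omega>. \<bar>S s (Suc i) \<omega> ^ 1 - S s i \<omega> ^ 1\<bar>) \<le> 1" for i
      by (intro integral_le_const integrable_bounded[of _ 1])
        (auto simp: S_Suc Y_bounded intro!: AE_I2)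
  qed auto
  have "expectation (\<lambda>\<omega>. S s (Suc n) \<omega> ^ 2)
      \<le> expectation (\<lambda>\<omega>. S s n \<omega> ^ 2 + 2 * (Y (s + n) \<omega> * S s n \<omega> ^ 1) + 1)"
  proof (rule integral_mono)
    fix \<omega> assume "\<omega> \<in> space M"
    then show "S s (Suc n) \<omega> ^ 2 \<le> S s n \<omega> ^ 2 + 2 * (Y (s + n) \<omega> * S s n \<omega> ^ 1) + 1"
      using Y_power_le_1(1)[of \<omega> "s + n" 2] by (simp add: S_Suc power2_eq_square algebra_simps)
  qed (intro Bochner_Integration.integrable_add integrable_S_power integrable_mult_right
      integrable_Y_mult integrable_const)+
  also have "\<dots> = expectation (\<lambda>\<omega>. S s n \<omega> ^ 2) + 2 * expectation (\<lambda>\<omega>. Y (s + n) \<omega> * S s n \<omega> ^ 1) + 1"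
    by (subst Bochner_Integration.integral_add Bochner_Integration.integral_mult_right;
        (intro Bochner_Integration.integrable_add integrable_S_power integrable_mult_right
          integrable_Y_mult integrable_const)?)+ (simp add: prob_space)
  also have "\<dots> \<le> (2 * suminf \<rho> + 1) * real (Suc n)"
    using a Suc by (simp add: algebra_simps)
  finally show ?case .
qed simp

text \<open>The critical term in the expansion of \<open>(S + Y) ^ 4\<close> is
  \<open>4 * Y * S ^ 3\<close>. The increments of \<open>S ^ 3\<close> are quadratic in
  \<open>S\<close>, so by the second moment bound they have mean of order \<open>n\<close>, and so
  does the critical term. Each step thus adds order \<open>n\<close>. The constant is uniform in the
  starting point \<open>s\<close>, as the dyadic recursion requires.\<close>

lemma fourth_moment_exists: "\<exists>C. \<forall>s n. expectation (\<lambda>\<omega>. S s n \<omega> ^ 4) \<le> C * real n ^ 2"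
proof -
  define R where "R = suminf \<rho>"
  define K where "K = 2 * R + 1"
  have R0: "0 \<le> R" unfolding R_def using \<rho>_summable \<rho>_nonneg by (intro suminf_nonneg)
  then have K0: "1 \<le> K" by (simp add: K_def)
  define D where "D = 6 * K + 4"
  \<comment> \<open>\<open>D\<close> bounds the increments of \<open>S ^ 3\<close> per unit of
    \<open>n\<close>; \<open>C\<close> collects all coefficients of one step, which is then at most
    \<open>C * (2 * n + 1) = C * ((n + 1)^2 - n^2)\<close>.\<close>
  define C where "C = 4 * R * D + 8 * K + 3"
  have C: "expectation (\<lambda>\<omega>. S s n \<omega> ^ 4) \<le> C * real n ^ 2" for s n
  proof (induction n)
    case (Suc n)
    have a: "\<bar>expectation (\<lambda>\<omega>. Y (s + n) \<omega> * S s n \<omega> ^ 3)\<bar> \<le> suminf \<rho> * (D * real n)"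
    proof (rule Y_mult_S_power_bound)
      fix i assume "i < n"
      have "expectation (\<lambda>\<omega>. \<bar>S s (Suc i) \<omega> ^ 3 - S s i \<omega> ^ 3\<bar>) \<le> expectation (\<lambda>\<omega>. 6 * S s i \<omega> ^ 2 + 4)"
      proof (rule integral_mono)
        fix \<omega> assume \<omega>: "\<omega> \<in> space M"
        define t y where "t = S s i \<omega>" and "y = Y (s + i) \<omega>"
        have y: "\<bar>y\<bar> \<le> 1" using Y_bounded[OF \<omega>] by (simp add: y_def)
        then have y2: "y\<^sup>2 \<le> 1" by (simp add: abs_square_le_1)
        have "(t + y) ^ 3 - t ^ 3 = y * (3 * t\<^sup>2 + 3 * (t * y) + y\<^sup>2)"
          by (simp add: power2_eq_square power3_eq_cube algebra_simps)
        then have "\<bar>(t + y) ^ 3 - t ^ 3\<bar> \<le> 1 * \<bar>3 * t\<^sup>2 + 3 * (t * y) + y\<^sup>2\<bar>"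
          using y by (simp only: abs_mult) (intro mult_right_mono; simp)
        moreover have "2 * (t * y) \<le> t\<^sup>2 + y\<^sup>2 \<and> - (2 * (t * y)) \<le> t\<^sup>2 + y\<^sup>2"
          using sum_squares_bound[of t y] sum_squares_bound[of "-t" y] by simp
        then have "\<bar>3 * t\<^sup>2 + 3 * (t * y) + y\<^sup>2\<bar> \<le> 6 * t\<^sup>2 + 4"
          using y2 zero_le_power2[of t] zero_le_power2[of y] unfolding abs_le_iff
          by (intro conjI; argo)
        ultimately have "\<bar>(t + y) ^ 3 - t ^ 3\<bar> \<le> 6 * t\<^sup>2 + 4" unfolding mult_1 by (rule order_trans)
        then show "\<bar>S s (Suc i) \<omega> ^ 3 - S s i \<omega> ^ 3\<bar> \<le> 6 * S s i \<omega> ^ 2 + 4"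
          by (simp add: S_Suc t_def y_def)
      qed (intro integrable_abs Bochner_Integration.integrable_diff Bochner_Integration.integrable_add
          integrable_S_power integrable_mult_right integrable_const)+
      also have "\<dots> = 6 * expectation (\<lambda>\<omega>. S s i \<omega> ^ 2) + 4"
        using integrable_S_power by (simp add: prob_space)
      also have "\<dots> \<le> 6 * (K * real i) + 4 * real n"
        using second_moment[of s i] \<open>i < n\<close> by (intro add_mono) (auto simp: K_def R_def)
      also have "\<dots> \<le> D * real n" using \<open>i < n\<close> K0 by (simp add: D_def algebra_simps)
      finally show "expectation (\<lambda>\<omega>. \<bar>S s (Suc i) \<omega> ^ 3 - S s i \<omega> ^ 3\<bar>) \<le> D * real n" .
    qed (use K0 in \<open>auto simp: D_def\<close>)
    have "expectation (\<lambda>\<omega>. S s (Suc n) \<omega> ^ 4)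
        \<le> expectation (\<lambda>\<omega>. S s n \<omega> ^ 4 + 4 * (Y (s + n) \<omega> * S s n \<omega> ^ 3) + 8 * S s n \<omega> ^ 2 + 3)"
    proof (rule integral_mono)
      fix \<omega> assume \<omega>: "\<omega> \<in> space M"
      define t y where "t = S s n \<omega>" and "y = Y (s + n) \<omega>"
      have y: "y ^ p \<le> 1" "\<bar>y ^ p\<bar> \<le> 1" for p using Y_power_le_1[OF \<omega>] by (auto simp: y_def)
      have "t * y ^ 3 \<le> \<bar>t\<bar> * \<bar>y ^ 3\<bar>" by (metis abs_ge_self abs_mult)
      also have "\<dots> \<le> \<bar>t\<bar> * 1" using y by (intro mult_left_mono) auto
      also have "\<dots> \<le> (t\<^sup>2 + 1) / 2"
        using sum_squares_bound[of "\<bar>t\<bar>" 1] by simp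
      finally have 1: "t * y ^ 3 \<le> (t\<^sup>2 + 1) / 2" .
      have 2: "t\<^sup>2 * y\<^sup>2 \<le> t\<^sup>2" using y[of 2] mult_left_mono[of "y\<^sup>2" 1 "t\<^sup>2"] by simp
      have "(t + y) ^ 4 = t ^ 4 + 4 * (y * t ^ 3) + 6 * (t\<^sup>2 * y\<^sup>2) + 4 * (t * y ^ 3) + y ^ 4"
        by (simp add: power4_eq_xxxx power2_eq_square power3_eq_cube algebra_simps)
      also have "\<dots> \<le> t ^ 4 + 4 * (y * t ^ 3) + 8 * t\<^sup>2 + 3"
        using 1 2 y(1)[of 4] by simp
      finally show "S s (Suc n) \<omega> ^ 4 \<le> S s n \<omega> ^ 4 + 4 * (Y (s + n) \<omega> * S s n \<omega> ^ 3) + 8 * S s n \<omega> ^ 2 + 3"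
        by (simp add: S_Suc t_def y_def)
    qed (intro Bochner_Integration.integrable_add integrable_S_power integrable_mult_right
        integrable_Y_mult integrable_const)+
    also have "\<dots> = expectation (\<lambda>\<omega>. S s n \<omega> ^ 4) + 4 * expectation (\<lambda>\<omega>. Y (s + n) \<omega> * S s n \<omega> ^ 3)
        + 8 * expectation (\<lambda>\<omega>. S s n \<omega> ^ 2) + 3"
      using integrable_S_power integrable_Y_mult by (simp add: prob_space)
    also have "\<dots> \<le> C * real n ^ 2 + 4 * (R * (D * real n)) + 8 * (K * real n) + 3"
      using a Suc second_moment[of s n] unfolding R_def[symmetric] K_def[symmetric] by auto
    also have "\<dots> \<le> C * real n ^ 2 + C * (2 * real n + 1)"
    proof -
      have "0 \<le> R * D * real n" "0 \<le> K * real n" "0 \<le> R * D" "0 \<le> K"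
        using R0 K0 by (auto simp: D_def)
      then show ?thesis by (simp add: C_def algebra_simps)
    qed
    also have "\<dots> = C * real (Suc n) ^ 2" by (simp add: power2_eq_square algebra_simps)
    finally show ?case .
  qed simp
  then show ?thesis by blast
qed

text \<open>\<open>Q k s\<close> dominates the fourth powers of all partial sums of length at most \<open>2 ^ k\<close> from \<open>s\<close>;
  by \<open>power4_add_le\<close> the two halves enter with total weight \<open>3\<close>, which is less than the factor \<open>4\<close> by
  which the fourth moment bound grows, so no logarithm is lost in the maximal inequality.\<close>

fun Q :: "nat \<Rightarrow> nat \<Rightarrow> 'w \<Rightarrow> real" where
  "Q 0 s \<omega> = 1"
| "Q (Suc k) s \<omega> = 1764 * S s (2 ^ k) \<omega> ^ 4 + 3 / 2 * (Q k s \<omega> + Q k (s + 2 ^ k) \<omega>)"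

lemma Q_nonneg: "0 \<le> Q k s \<omega>"
  by (induction k arbitrary: s) auto

text \<open>Induction on the dyadic scale. A sum reaching past the midpoint is the complete first
  half, which takes the large weight 1764, plus a partial sum of the second half; a shorter sum is
  already controlled by \<open>Q k s\<close>.\<close>

lemma S_power4_le_Q:
  assumes "\<omega> \<in> space M" "n \<le> 2 ^ k"
  shows "S s n \<omega> ^ 4 \<le> Q k s \<omega>"
  using assms(2)
proof (induction k arbitrary: s n)
  case 0
  have "\<bar>S s n \<omega>\<bar> \<le> 1" using S_bounded[OF assms(1), of s n] 0 by simp
  then have "\<bar>S s n \<omega>\<bar> ^ 4 \<le> 1" by (intro power_le_one) auto
  then show ?case by simp
next
  case (Suc k)
  show ?case
  proof (cases "n \<le> 2 ^ k")
    case True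
    have "0 \<le> S s (2 ^ k) \<omega> ^ 4" by simp
    moreover have "x \<le> 1764 * a + 3 / 2 * (b + c)" if "0 \<le> a" "x \<le> b" "0 \<le> b" "0 \<le> c" for a b c x :: real
      using that by argo
    ultimately show ?thesis
      using Suc.IH[OF True, of s] Q_nonneg[of k s \<omega>] Q_nonneg[of k "s + 2 ^ k" \<omega>]
      unfolding Q.simps by blast
  next
    case False
    define r where "r = n - 2 ^ k"
    have n: "n = 2 ^ k + r" and r: "r \<le> 2 ^ k" using False Suc.prems by (auto simp: r_def)
    have "S s n \<omega> ^ 4 \<le> 1764 * S s (2 ^ k) \<omega> ^ 4 + 3 / 2 * S (s + 2 ^ k) r \<omega> ^ 4"
      unfolding n S_add by (rule power4_add_le)
    then show ?thesis
      using Suc.IH[OF r, of "s + 2 ^ k"] Q_nonneg[of k s \<omega>] unfolding Q.simps by argo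
  qed
qed

lemma integrable_Q: "integrable M (Q k s)"
proof (induction k arbitrary: s)
  case (Suc k)
  have "Q (Suc k) s = (\<lambda>\<omega>. 1764 * S s (2 ^ k) \<omega> ^ 4 + 3 / 2 * (Q k s \<omega> + Q k (s + 2 ^ k) \<omega>))"
    by auto
  then show ?case using Suc integrable_S_power by simp
next
  case 0
  have "Q 0 s = (\<lambda>\<omega>. 1)" by auto
  then show ?case by simp
qed

lemma Q_expectation_exists: "\<exists>B. \<forall>k s. expectation (Q k s) \<le> B * 4 ^ k"
proof -
  obtain C where C: "expectation (\<lambda>\<omega>. S s n \<omega> ^ 4) \<le> C * real n ^ 2" for s n
    using fourth_moment_exists by blast
  \<comment> \<open>The 1 serves scale 0; \<open>1764 * C \<le> B\<close> lets the new term take the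
    fourth share of \<open>4 * B * 4 ^ k\<close>, the two halves taking three.\<close>
  define B where "B = max 1 (1764 * C)"
  have "expectation (Q k s) \<le> B * 4 ^ k" for k s
  proof (induction k arbitrary: s)
    case 0
    have "Q 0 s = (\<lambda>\<omega>. 1)" by auto
    then show ?case by (simp add: prob_space B_def)
  next
    case (Suc k)
    have "Q (Suc k) s = (\<lambda>\<omega>. 1764 * S s (2 ^ k) \<omega> ^ 4 + 3 / 2 * (Q k s \<omega> + Q k (s + 2 ^ k) \<omega>))"
      by auto
    then have "expectation (Q (Suc k) s) = 1764 * expectation (\<lambda>\<omega>. S s (2 ^ k) \<omega> ^ 4)
        + 3 / 2 * (expectation (Q k s) + expectation (Q k (s + 2 ^ k)))"
      using integrable_S_power integrable_Q by simp
    also have "\<dots> \<le> 1764 * (C * 4 ^ k) + 3 / 2 * (B * 4 ^ k + B * 4 ^ k)"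
      using C[of s "2 ^ k"] by (intro add_mono mult_left_mono Suc) (auto simp: power_mult [symmetric] power_mult_distrib power2_eq_square simp flip: power_mult_distrib)
    also have "\<dots> = (1764 * C) * 4 ^ k + 3 * B * 4 ^ k" by simp
    also have "\<dots> \<le> B * 4 ^ k + 3 * B * 4 ^ k"
      by (intro add_mono mult_right_mono) (auto simp: B_def)
    finally show ?case by (simp only: power_Suc mult.left_commute)
  qed
  then show ?thesis by blast
qed

text \<open>A Borel-Cantelli argument along the scales \<open>2 ^ k\<close>: the normalized maximal
  bounds \<open>Z k\<close> have summable expectations, hence tend to 0 almost surely, and every
  \<open>n\<close> is compared with the dyadic scale just above it.\<close>

lemma AE_sum_limit:
  "AE \<omega> in M. (\<lambda>n. (\<Sum>i<n. Y i \<omega>)\<^sup>2 / (real n * ln (real n))) \<longlonglongrightarrow> 0"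
proof -
  obtain B where B: "expectation (Q k s) \<le> B * 4 ^ k" for k s
    using Q_expectation_exists by blast
  \<comment> \<open>The factor \<open>k^2\<close> makes the expectations summable and corresponds to
    \<open>(ln n)^2\<close> at \<open>n\<close> near \<open>2 ^ k\<close>. At \<open>k = 0\<close>
    the quotient is 0 by convention.\<close>
  define Z where "Z k \<omega> = Q k 0 \<omega> / (4 ^ k * real k ^ 2)" for k \<omega>
  have Z0: "0 \<le> Z k \<omega>" for k \<omega> by (simp add: Z_def Q_nonneg)
  have int: "integrable M (Z k)" for k unfolding Z_def using integrable_Q by simp
  have EZ: "expectation (Z k) \<le> B * (1 / real k ^ 2)" for k
    using B[of k 0] unfolding Z_def by (cases "k = 0") (auto simp: field_simps)
  have "summable (\<lambda>k. expectation (Z k))"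
  proof (rule summable_comparison_test')
    show "summable (\<lambda>k. B * (1 / real k ^ 2))"
      using inverse_power_summable[of 2, where 'a = real] by (intro summable_mult) (simp add: field_simps)
    show "norm (expectation (Z k)) \<le> B * (1 / real k ^ 2)" for k
      using EZ[of k] Bochner_Integration.integral_nonneg[of M "Z k"] Z0 by simp
  qed
  then have "(\<Sum>k. ennreal (expectation (Z k))) \<noteq> \<infinity>"
    using Z0 by (subst suminf_ennreal2) auto
  moreover have "(\<Sum>k. ennreal (expectation (Z k))) = (\<integral>\<^sup>+ \<omega>. (\<Sum>k. ennreal (Z k \<omega>)) \<partial>M)"
    using int Z0 by (subst nn_integral_suminf) (auto simp: nn_integral_eq_integral)
  ultimately have "AE \<omega> in M. (\<Sum>k. ennreal (Z k \<omega>)) \<noteq> \<infinity>"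
    using int by (intro nn_integral_PInf_AE) auto
  then show ?thesis using AE_space
  proof eventually_elim
    case (elim \<omega>)
    have "summable (\<lambda>k. Z k \<omega>)" using elim(1) Z0 by (intro summable_suminf_not_top) auto
    then have lim: "(\<lambda>k. Z k \<omega>) \<longlonglongrightarrow> 0" by (rule summable_LIMSEQ_zero)
    \<comment> \<open>The least exponent whose power of 2 reaches \<open>n\<close>.\<close>
    define \<kappa> where "\<kappa> n = nat \<lceil>log 2 (real n)\<rceil>" for n
    have \<kappa>: "n \<le> 2 ^ \<kappa> n" "2 ^ \<kappa> n \<le> 2 * real n" "real (\<kappa> n) \<le> 4 * ln (real n)" if "2 \<le> n" for n
    proof -
      have l1: "1 \<le> log 2 (real n)" using that by simp
      have "real n = 2 powr (log 2 (real n))" using that by simp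
      also have "\<dots> \<le> 2 powr (real (\<kappa> n))" unfolding \<kappa>_def by (intro powr_mono) (auto simp: real_nat_ceiling_ge)
      finally show "n \<le> 2 ^ \<kappa> n" by (simp add: powr_realpow)
      have k1: "real (\<kappa> n) \<le> log 2 (real n) + 1" unfolding \<kappa>_def using l1 by linarith
      then have "2 powr real (\<kappa> n) \<le> 2 powr (log 2 (real n) + 1)" by simp
      also have "\<dots> = 2 * real n" using that by (simp add: powr_add)
      finally show "2 ^ \<kappa> n \<le> 2 * real n" by (simp add: powr_realpow)
      have "real (\<kappa> n) \<le> 2 * log 2 (real n)" using k1 l1 by simp
      also have "\<dots> \<le> 4 * ln (real n)"
      proof -
        have "1 / 2 \<le> ln (2::real)" using ln2_ge_two_thirds by simp
        then have "ln (real n) / ln 2 \<le> ln (real n) / (1/2)" using that by (intro divide_left_mono) auto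
        then show ?thesis by (simp add: log_def)
      qed
      finally show "real (\<kappa> n) \<le> 4 * ln (real n)" .
    qed
    have \<kappa>_lim: "filterlim \<kappa> at_top sequentially"
    proof -
      have "filterlim (\<lambda>n. real (\<kappa> n)) at_top sequentially"
      proof (rule filterlim_at_top_mono)
        show "filterlim (\<lambda>n. log 2 (real n)) at_top sequentially" by real_asymp
        show "\<forall>\<^sub>F n in sequentially. log 2 (real n) \<le> real (\<kappa> n)"
          by (simp add: \<kappa>_def real_nat_ceiling_ge)
      qed
      then show ?thesis by (simp add: filterlim_sequentially_iff_filterlim_real)
    qed
    have "(\<lambda>n. 64 * Z (\<kappa> n) \<omega>) \<longlonglongrightarrow> 64 * 0"
      by (intro tendsto_mult tendsto_const filterlim_compose[OF lim \<kappa>_lim])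
    then have lim': "(\<lambda>n. 64 * Z (\<kappa> n) \<omega>) \<longlonglongrightarrow> 0" by simp
    define u where "u n = (\<Sum>i<n. Y i \<omega>)\<^sup>2 / (real n * ln (real n))" for n
    have "(\<lambda>n. (u n)\<^sup>2) \<longlonglongrightarrow> 0"
    proof (rule tendsto_sandwich[OF _ _ tendsto_const lim'])
      show "\<forall>\<^sub>F n in sequentially. (u n)\<^sup>2 \<le> 64 * Z (\<kappa> n) \<omega>"
      proof (intro eventually_sequentiallyI[of 2])
        fix n :: nat assume n: "2 \<le> n"
        have ln: "0 < ln (real n)" using n by simp
        have k: "0 < \<kappa> n" using \<kappa>(1)[OF n] n by (cases "\<kappa> n") auto
        have "(u n)\<^sup>2 = S 0 n \<omega> ^ 4 / (real n * ln (real n))\<^sup>2"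
          by (simp add: u_def S_def power_divide power_mult [symmetric])
        also have "\<dots> \<le> Q (\<kappa> n) 0 \<omega> / (real n * ln (real n))\<^sup>2"
          using \<kappa>(1)[OF n] elim(2) by (intro divide_right_mono S_power4_le_Q) auto
        \<comment> \<open>The 8 is the product of the factors in
          \<open>2 ^ \<kappa> n \<le> 2 * n\<close> and \<open>\<kappa> n \<le> 4 * ln n\<close>;
          squared it becomes 64.\<close>
        also have "\<dots> \<le> Q (\<kappa> n) 0 \<omega> / ((2 ^ \<kappa> n * real (\<kappa> n)) / 8)\<^sup>2"
        proof (intro divide_left_mono Q_nonneg power_mono mult_pos_pos zero_less_power)
          have "2 ^ \<kappa> n * real (\<kappa> n) \<le> (2 * real n) * (4 * ln (real n))"
            using \<kappa>[OF n] by (intro mult_mono) auto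
          then show "2 ^ \<kappa> n * real (\<kappa> n) / 8 \<le> real n * ln (real n)" by simp
        qed (use k n ln in auto)
        also have "\<dots> = 64 * Z (\<kappa> n) \<omega>"
        proof -
          have "(2 ^ \<kappa> n)\<^sup>2 = (4::real) ^ \<kappa> n" unfolding power2_eq_square power_mult_distrib [symmetric] by simp
          then show ?thesis by (simp add: Z_def power_divide power_mult_distrib)
        qed
        finally show "(u n)\<^sup>2 \<le> 64 * Z (\<kappa> n) \<omega>" .
      qed
    qed simp
    then have "(\<lambda>n. sqrt ((u n)\<^sup>2)) \<longlonglongrightarrow> sqrt 0" by (rule tendsto_real_sqrt)
    then have "(\<lambda>n. \<bar>u n\<bar>) \<longlonglongrightarrow> 0" by simp
    then show "(\<lambda>n. (\<Sum>i<n. Y i \<omega>)\<^sup>2 / (real n * ln (real n))) \<longlonglongrightarrow> 0"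
      unfolding tendsto_rabs_zero_iff by (simp add: u_def [abs_def])
  qed
qed

end

section \<open>Empirical frequencies under mixing\<close>

lemma sets_eq_of_count_space:
  assumes "f \<in> measurable M (count_space S)"
  shows "{\<omega> \<in> space M. f \<omega> = y} \<in> sets M"
proof (cases "y \<in> S")
  case True
  have "{\<omega> \<in> space M. f \<omega> = y} = f -` {y} \<inter> space M" by auto
  then show ?thesis using measurable_sets[OF assms, of "{y}"] True by simp
next
  case False
  then have "{\<omega> \<in> space M. f \<omega> = y} = {}" using measurable_space[OF assms] by auto
  then show ?thesis by (metis sets.empty_sets)
qed

text \<open>The past \<open>X 1, ..., X m\<close> takes finitely many values, and \<open>g\<close>
  is constant on each of the corresponding events. Mixing, applied to a future block of length one,
  bounds the integral over each event; the bounds are then added.\<close>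

lemma mixing_covariance_bound:
  fixes g :: "'w \<Rightarrow> real"
  assumes "prob_space M" and "finite S"
    and X: "\<And>i. 1 \<le> i \<Longrightarrow> X i \<in> measurable M (count_space S)"
    and mix: "mixing_with_rate M S X \<psi>"
    and m: "1 \<le> m" and l: "1 \<le> l" and n: "m + l \<le> n" and y: "y \<in> S"
    and g: "\<And>\<omega> \<omega>'. \<omega> \<in> space M \<Longrightarrow> \<omega>' \<in> space M \<Longrightarrow> (\<forall>i\<in>{1..m}. X i \<omega> = X i \<omega>') \<Longrightarrow> g \<omega> = g \<omega>'"
  shows "\<bar>\<integral>\<omega>. (of_bool (X n \<omega> = y) - \<P>(\<omega> in M. X n \<omega> = y)) * g \<omega> \<partial>M\<bar> \<le> \<bar>\<psi> l\<bar> * (\<integral>\<omega>. \<bar>g \<omega>\<bar> \<partial>M)"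
proof -
  interpret prob_space M by fact
  define p where "p = \<P>(\<omega> in M. X n \<omega> = y)"
  define D where "D = {x. set x \<subseteq> S \<and> length x = m}"
  define B where "B x = {\<omega> \<in> space M. block X 1 m \<omega> = x}" for x
  define Yn where "Yn = {\<omega> \<in> space M. X n \<omega> = y}"
  have finD: "finite D" unfolding D_def using \<open>finite S\<close> by (rule finite_lists_length_eq)
  have blockD: "block X 1 m \<omega> \<in> D" if "\<omega> \<in> space M" for \<omega>
    using measurable_space[OF X that] by (auto simp: block_def D_def)
  have block_eq: "block X 1 m \<omega> = block X 1 m \<omega>' \<longleftrightarrow> (\<forall>i\<in>{1..m}. X i \<omega> = X i \<omega>')" for \<omega> \<omega>'
    unfolding block_def map_eq_conv by auto
  have Yn [measurable]: "Yn \<in> sets M"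
    unfolding Yn_def using m n by (intro sets_eq_of_count_space[OF X]) auto
  have B [measurable]: "B x \<in> sets M" if "x \<in> D" for x
  proof -
    have "B x = {\<omega> \<in> space M. \<forall>i\<in>{..<m}. X (Suc i) \<omega> = x ! i}"
      using that unfolding B_def D_def block_def
      by (auto simp: list_eq_iff_nth_eq simp del: upt_Suc)
    moreover have "{\<omega> \<in> space M. \<forall>i\<in>{..<m}. X (Suc i) \<omega> = x ! i} \<in> sets M"
      by (intro sets.sets_Collect_finite_All' sets_eq_of_count_space[OF X]) (use m in \<open>auto simp: lessThan_empty_iff\<close>)
    ultimately show ?thesis by simp
  qed
  have int: "integrable M (indicator (B x) :: 'w \<Rightarrow> real)"
      "integrable M (indicator (Yn \<inter> B x) :: 'w \<Rightarrow> real)"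
      "(\<integral>\<omega>. indicator (B x) \<omega> \<partial>M) = prob (B x)"
      "(\<integral>\<omega>. indicator (Yn \<inter> B x) \<omega> \<partial>M) = prob (Yn \<inter> B x)" if "x \<in> D" for x
    using B[OF that] Yn
    by (auto simp: less_top [symmetric] Int_absorb2 sets.sets_into_space intro!: integrable_real_indicator)
  \<comment> \<open>The constant value of \<open>g\<close> on \<open>B x\<close>. If
    \<open>B x\<close> is empty the value is arbitrary, but it is always multiplied by a quantity
    vanishing on \<open>B x\<close>.\<close>
  define h where "h x = g (SOME \<omega>. \<omega> \<in> B x)" for x
  have h: "g \<omega> = h x" if "\<omega> \<in> B x" for \<omega> x
  proof -
    have "(SOME \<omega>. \<omega> \<in> B x) \<in> B x" using that by (rule someI)
    then show ?thesis unfolding h_def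
      using that block_eq[of \<omega> "SOME \<omega>. \<omega> \<in> B x"] by (intro g) (simp_all add: B_def)
  qed
  have split: "f \<omega> = (\<Sum>x\<in>D. f \<omega> * indicator (B x) \<omega>)" if "\<omega> \<in> space M" for f :: "'w \<Rightarrow> real" and \<omega>
  proof -
    have "(\<Sum>x\<in>D. f \<omega> * indicator (B x) \<omega>) = (\<Sum>x\<in>{block X 1 m \<omega>}. f \<omega>)"
      using finD blockD[OF that] that
      by (intro sum.mono_neutral_cong_right) (auto simp: B_def indicator_def)
    then show ?thesis by simp
  qed
  have "(\<integral>\<omega>. \<bar>g \<omega>\<bar> \<partial>M) = (\<integral>\<omega>. (\<Sum>x\<in>D. \<bar>h x\<bar> * indicator (B x) \<omega>) \<partial>M)"
  proof (rule Bochner_Integration.integral_cong[OF refl])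
    fix \<omega> assume \<omega>: "\<omega> \<in> space M"
    show "\<bar>g \<omega>\<bar> = (\<Sum>x\<in>D. \<bar>h x\<bar> * indicator (B x) \<omega>)"
      by (subst split[OF \<omega>], intro sum.cong) (auto simp: indicator_def h)
  qed
  also have "\<dots> = (\<Sum>x\<in>D. \<bar>h x\<bar> * prob (B x))"
    using int by (subst Bochner_Integration.integral_sum) auto
  finally have Eg: "(\<integral>\<omega>. \<bar>g \<omega>\<bar> \<partial>M) = (\<Sum>x\<in>D. \<bar>h x\<bar> * prob (B x))" .
  have "(\<integral>\<omega>. (of_bool (X n \<omega> = y) - p) * g \<omega> \<partial>M)
      = (\<integral>\<omega>. (\<Sum>x\<in>D. h x * (indicator (Yn \<inter> B x) \<omega> - p * indicator (B x) \<omega>)) \<partial>M)"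
  proof (rule Bochner_Integration.integral_cong[OF refl])
    fix \<omega> assume \<omega>: "\<omega> \<in> space M"
    show "(of_bool (X n \<omega> = y) - p) * g \<omega> = (\<Sum>x\<in>D. h x * (indicator (Yn \<inter> B x) \<omega> - p * indicator (B x) \<omega>))"
      using \<omega> by (subst split[OF \<omega>], intro sum.cong) (auto simp: indicator_def h Yn_def)
  qed
  also have "\<dots> = (\<Sum>x\<in>D. h x * (prob (Yn \<inter> B x) - p * prob (B x)))"
    using int by (subst Bochner_Integration.integral_sum) (auto intro!: sum.cong)
  finally have "\<bar>\<integral>\<omega>. (of_bool (X n \<omega> = y) - p) * g \<omega> \<partial>M\<bar>
      \<le> (\<Sum>x\<in>D. \<bar>h x\<bar> * \<bar>prob (Yn \<inter> B x) - p * prob (B x)\<bar>)"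
    by (simp add: abs_mult order_trans[OF sum_abs])
  also have "\<dots> \<le> (\<Sum>x\<in>D. \<bar>h x\<bar> * (\<bar>\<psi> l\<bar> * prob (B x)))"
  proof (intro sum_mono mult_left_mono)
    fix x assume x: "x \<in> D"
    have p: "0 \<le> p" "p \<le> 1" by (auto simp: p_def)
    show "\<bar>prob (Yn \<inter> B x) - p * prob (B x)\<bar> \<le> \<bar>\<psi> l\<bar> * prob (B x)"
    \<comment> \<open>Mixing says nothing about pasts of probability zero; for these both sides
      vanish.\<close>
    proof (cases "prob (B x) = 0")
      case True
      have "prob (Yn \<inter> B x) \<le> prob (B x)" using B[OF x] by (intro finite_measure_mono) auto
      then show ?thesis using True by (simp add: measure_le_0_iff)
    next
      case False
      then have pos: "0 < prob (B x)" by (simp add: zero_less_measure_iff)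
      have single: "block X n (n + 1 - 1) \<omega> = [y] \<longleftrightarrow> X n \<omega> = y" for \<omega>
        by (simp add: block_def)
      have "\<bar>\<P>(\<omega> in M. block X n (n + 1 - 1) \<omega> = [y] \<bar> block X 1 m \<omega> = x)
           - \<P>(\<omega> in M. block X n (n + 1 - 1) \<omega> = [y])\<bar>
          \<le> \<psi> l * \<P>(\<omega> in M. block X n (n + 1 - 1) \<omega> = [y])"
        using mix m l n y x pos unfolding mixing_with_rate_def D_def B_def
        by (elim allE[of _ 1] allE[of _ m] allE[of _ l] allE[of _ n] allE[of _ "[y]"] allE[of _ x] impE) auto
      moreover have "{\<omega> \<in> space M. X n \<omega> = y \<and> block X 1 m \<omega> = x} = Yn \<inter> B x"
        by (auto simp: Yn_def B_def)
      ultimately have "\<bar>prob (Yn \<inter> B x) / prob (B x) - p\<bar> \<le> \<psi> l * p"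
        unfolding single cond_prob_def p_def[symmetric]
        by (simp only: B_def)
      \<comment> \<open>The factor \<open>p \<le> 1\<close> is given away, and the absolute value
        yields a nonnegative rate.\<close>
      also have "\<dots> \<le> \<bar>\<psi> l\<bar> * 1" using p by (intro mult_mono abs_ge_self abs_ge_zero)
      finally have "\<bar>prob (Yn \<inter> B x) / prob (B x) - p\<bar> * prob (B x) \<le> \<bar>\<psi> l\<bar> * prob (B x)"
        by (intro mult_right_mono) auto
      moreover have "\<bar>prob (Yn \<inter> B x) / prob (B x) - p\<bar> * prob (B x)
          = \<bar>(prob (Yn \<inter> B x) / prob (B x) - p) * prob (B x)\<bar>"
        by (simp add: abs_mult)
      ultimately show ?thesis using pos by (simp add: left_diff_distrib)
    qed
  qed auto
  also have "\<dots> = \<bar>\<psi> l\<bar> * (\<Sum>x\<in>D. \<bar>h x\<bar> * prob (B x))"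
    by (simp add: sum_distrib_left mult.left_commute)
  finally show ?thesis unfolding Eg p_def .
qed

lemma stationary_marginal:
  assumes "stationary_process M S X" "1 \<le> i" "y \<in> S"
  shows "\<P>(\<omega> in M. X i \<omega> = y) = \<P>(\<omega> in M. X 1 \<omega> = y)"
proof -
  have "\<P>(\<omega> in M. block X (i - 1 + 1) (i - 1 + 1) \<omega> = [y]) = \<P>(\<omega> in M. block X 1 1 \<omega> = [y])"
    using assms unfolding stationary_process_def
    by (elim allE[of _ 1] allE[of _ "i - 1"] allE[of _ "[y]"] impE) auto
  then show ?thesis using assms(2) by (simp add: block_def)
qed

lemma AE_count_limit:
  assumes "prob_space M" and "finite S"
    and X: "\<And>i. 1 \<le> i \<Longrightarrow> X i \<in> measurable M (count_space S)"
    and "stationary_process M S X" and "mixing_with_rate M S X \<psi>"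
    and "0 < \<epsilon>" and "\<psi> \<in> O(\<lambda>l. 1 / real l powr (1 + \<epsilon>))" and y: "y \<in> S"
  shows "AE \<omega> in M. (\<lambda>n. (real (card {i\<in>{1..n}. X i \<omega> = y}) - real n * \<P>(\<omega> in M. X 1 \<omega> = y))\<^sup>2
      / (real n * ln (real n))) \<longlonglongrightarrow> 0"
proof -
  define p where "p = \<P>(\<omega> in M. X 1 \<omega> = y)"
  \<comment> \<open>The process starts at index 1 and \<open>weakly_dependent\<close> sums from 0,
    hence the shift.\<close>
  define Y where "Y i \<omega> = of_bool (X (Suc i) \<omega> = y) - p" for i \<omega>
  interpret prob_space M by fact
  have p: "0 \<le> p" "p \<le> 1" by (auto simp: p_def)
  interpret weakly_dependent M Y "\<lambda>l. \<bar>\<psi> l\<bar>"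
  proof unfold_locales
    fix i
    have "{\<omega> \<in> space M. X (Suc i) \<omega> = y} \<in> sets M"
      by (intro sets_eq_of_count_space[OF X]) auto
    then have [measurable]: "Measurable.pred M (\<lambda>\<omega>. X (Suc i) \<omega> = y)"
      by (simp add: pred_def)
    show "Y i \<in> borel_measurable M" unfolding Y_def by measurable
    show "\<bar>Y i \<omega>\<bar> \<le> 1" for \<omega> using p by (simp add: Y_def)
  next
    show "summable (\<lambda>l. \<bar>\<psi> l\<bar>)"
    proof (rule summable_comparison_test_bigo)
      show "summable (\<lambda>l. norm (1 / real l powr (1 + \<epsilon>)))"
        using \<open>0 < \<epsilon>\<close> summable_real_powr_iff[of "- (1 + \<epsilon>)"]
        by (simp add: powr_minus [symmetric] divide_inverse)
      show "(\<lambda>l. \<bar>\<psi> l\<bar>) \<in> O(\<lambda>l. 1 / real l powr (1 + \<epsilon>))" using assms(7) by simp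
    qed
  next
    fix i k and g :: "'a \<Rightarrow> real"
    assume "i < k" and g: "\<And>\<omega> \<omega>'. \<omega> \<in> space M \<Longrightarrow> \<omega>' \<in> space M \<Longrightarrow> \<forall>j\<le>i. Y j \<omega> = Y j \<omega>' \<Longrightarrow> g \<omega> = g \<omega>'"
    have "\<bar>expectation (\<lambda>\<omega>. (of_bool (X (Suc k) \<omega> = y) - \<P>(\<omega> in M. X (Suc k) \<omega> = y)) * g \<omega>)\<bar>
        \<le> \<bar>\<psi> (k - i)\<bar> * expectation (\<lambda>\<omega>. \<bar>g \<omega>\<bar>)"
    \<comment> \<open>A function of \<open>Y 0, ..., Y i\<close> is a function of
      \<open>X 1, ..., X (Suc i)\<close>, and \<open>Suc k\<close> lies exactly \<open>k - i\<close>
      beyond \<open>Suc i\<close>.\<close>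
    proof (rule mixing_covariance_bound[OF assms(1,2) X assms(5), of "Suc i"])
      show "g \<omega> = g \<omega>'" if "\<omega> \<in> space M" "\<omega>' \<in> space M" "\<forall>j\<in>{1..Suc i}. X j \<omega> = X j \<omega>'" for \<omega> \<omega>'
        using that by (intro g) (auto simp: Y_def)
    qed (use \<open>i < k\<close> y in auto)
    then show "\<bar>expectation (\<lambda>\<omega>. Y k \<omega> * g \<omega>)\<bar> \<le> \<bar>\<psi> (k - i)\<bar> * expectation (\<lambda>\<omega>. \<bar>g \<omega>\<bar>)"
      using stationary_marginal[OF assms(4) _ y, of "Suc k"] by (simp add: Y_def p_def)
  qed auto
  have "(\<Sum>i<n. Y i \<omega>) = real (card {i\<in>{1..n}. X i \<omega> = y}) - real n * p" for n \<omega>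
  proof -
    have "(\<Sum>i<n. of_bool (X (Suc i) \<omega> = y)) = (\<Sum>i\<in>{1..n}. of_bool (X i \<omega> = y) :: real)"
      by (rule sum.reindex_bij_witness[of _ "\<lambda>i. i - 1" Suc]) auto
    also have "\<dots> = real (card {i\<in>{1..n}. X i \<omega> = y})" by (simp add: Int_def)
    finally show ?thesis by (simp add: Y_def sum_subtractf)
  qed
  then show ?thesis using AE_sum_limit by (simp add: p_def)
qed

section \<open>Marginals and Markov neighborhoods\<close>

locale finite_configurations =
  fixes V :: "nat set" and A :: "'a set"
  assumes finite_V: "finite V" and finite_A: "finite A"
begin

abbreviation \<Omega> :: "(nat \<Rightarrow> 'a) set" where "\<Omega> \<equiv> V \<rightarrow>\<^sub>E A"

definition cyl :: "nat set \<Rightarrow> (nat \<Rightarrow> 'a) \<Rightarrow> (nat \<Rightarrow> 'a) set" where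
  "cyl W y = {z \<in> \<Omega>. \<forall>u\<in>W. z u = y u}"

text \<open>Marginals are evaluated at full configurations, of which only the values on
  \<open>W\<close> matter, so all sums range over the single index set \<open>\<Omega>\<close>. The
  weight \<open>q\<close> is arbitrary: probabilities, counts and their differences all
  occur.\<close>

definition marg :: "((nat \<Rightarrow> 'a) \<Rightarrow> real) \<Rightarrow> nat set \<Rightarrow> (nat \<Rightarrow> 'a) \<Rightarrow> real" where
  "marg q W y = sum q (cyl W y)"

lemma finite_\<Omega>: "finite \<Omega>" by (intro finite_PiE finite_V finite_A)

lemma finite_cyl: "finite (cyl W y)"
  using finite_\<Omega> by (simp add: cyl_def)

lemma cyl_subset: "cyl W y \<subseteq> \<Omega>" by (auto simp: cyl_def)

lemma update_in_\<Omega>: "z \<in> \<Omega> \<Longrightarrow> v \<in> V \<Longrightarrow> a \<in> A \<Longrightarrow> z(v := a) \<in> \<Omega>"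
  by (auto simp: PiE_def extensional_def Pi_def)

lemma marg_cong: "(\<And>u. u \<in> W \<Longrightarrow> y u = z u) \<Longrightarrow> marg q W y = marg q W z"
  unfolding marg_def cyl_def by (intro arg_cong[where f = "sum q"]) auto

lemma marg_V: "y \<in> \<Omega> \<Longrightarrow> marg q V y = q y"
proof -
  assume "y \<in> \<Omega>"
  then have "cyl V y = {y}" unfolding cyl_def by (auto intro: PiE_ext)
  then show ?thesis by (simp add: marg_def)
qed

lemma marg_eq_sum: "marg q W y = (\<Sum>z\<in>\<Omega>. of_bool (\<forall>u\<in>W. z u = y u) * q z)"
  unfolding marg_def cyl_def using finite_\<Omega>
  by (intro sum.mono_neutral_cong_left) auto

lemma marg_nonneg: "(\<And>z. z \<in> \<Omega> \<Longrightarrow> 0 \<le> q z) \<Longrightarrow> 0 \<le> marg q W y"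
  unfolding marg_def using cyl_subset by (intro sum_nonneg) blast

lemma marg_antimono: "(\<And>z. z \<in> \<Omega> \<Longrightarrow> 0 \<le> q z) \<Longrightarrow> W \<subseteq> U \<Longrightarrow> marg q U y \<le> marg q W y"
  unfolding marg_def using finite_cyl by (intro sum_mono2) (auto simp: cyl_def)

lemma le_marg: "(\<And>z. z \<in> \<Omega> \<Longrightarrow> 0 \<le> q z) \<Longrightarrow> y \<in> \<Omega> \<Longrightarrow> q y \<le> marg q W y"
  unfolding marg_def using finite_cyl by (intro member_le_sum) (auto simp: cyl_def)

text \<open>Both sides are the sum of \<open>q y * f y * q' z\<close> over pairs \<open>y\<close>,
  \<open>z\<close> that agree on \<open>W\<close>, where \<open>f y = f z\<close>. This exchanges
  the weight with the marginal in the entropy estimates.\<close>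

lemma marg_swap:
  assumes "\<And>y z. y \<in> \<Omega> \<Longrightarrow> z \<in> \<Omega> \<Longrightarrow> (\<forall>u\<in>W. y u = z u) \<Longrightarrow> f y = f z"
  shows "(\<Sum>y\<in>\<Omega>. q y * f y * marg q' W y) = (\<Sum>y\<in>\<Omega>. q' y * f y * marg q W y)"
proof -
  have "(\<Sum>y\<in>\<Omega>. q y * f y * marg q' W y) = (\<Sum>y\<in>\<Omega>. \<Sum>z\<in>\<Omega>. q y * f y * (of_bool (\<forall>u\<in>W. z u = y u) * q' z))"
    by (simp add: marg_eq_sum sum_distrib_left)
  also have "\<dots> = (\<Sum>z\<in>\<Omega>. \<Sum>y\<in>\<Omega>. q y * f y * (of_bool (\<forall>u\<in>W. z u = y u) * q' z))"
    by (rule sum.swap)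
  also have "\<dots> = (\<Sum>z\<in>\<Omega>. \<Sum>y\<in>\<Omega>. q' z * f z * (of_bool (\<forall>u\<in>W. y u = z u) * q y))"
  proof (intro sum.cong refl)
    fix y z assume "y \<in> \<Omega>" "z \<in> \<Omega>"
    moreover have "(\<forall>u\<in>W. z u = y u) \<longleftrightarrow> (\<forall>u\<in>W. y u = z u)" by auto
    ultimately show "q y * f y * (of_bool (\<forall>u\<in>W. z u = y u) * q' z) = q' z * f z * (of_bool (\<forall>u\<in>W. y u = z u) * q y)"
      using assms[of y z] by (cases "\<forall>u\<in>W. y u = z u") auto
  qed
  also have "\<dots> = (\<Sum>y\<in>\<Omega>. q' y * f y * marg q W y)"
    by (simp add: marg_eq_sum sum_distrib_left)
  finally show ?thesis .
qed

text \<open>Total probability over the value at \<open>v\<close>: the index \<open>y\<close> runs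
  through the updates of \<open>z\<close> at \<open>v\<close>, and these sort the cylinder over
  \<open>W\<close> by the value at \<open>v\<close>.\<close>

lemma sum_marg_cyl_update:
  assumes v: "v \<in> V" and W: "W \<subseteq> V - {v}" and z: "z \<in> \<Omega>"
  shows "(\<Sum>y\<in>cyl (V - {v}) z. marg q (insert v W) y) = marg q W z"
proof -
  have "(\<Sum>y\<in>cyl (V - {v}) z. marg q (insert v W) y) = (\<Sum>y\<in>cyl (V - {v}) z. sum q {x \<in> cyl W z. z(v := x v) = y})"
  proof (intro sum.cong refl)
    fix y assume y: "y \<in> cyl (V - {v}) z"
    have eq: "z(v := x v) = y \<longleftrightarrow> x v = y v" for x
    proof
      assume "x v = y v"
      show "z(v := x v) = y"
      proof
        fix u show "(z(v := x v)) u = y u"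
          using y z \<open>x v = y v\<close> by (cases "u \<in> V") (auto simp: cyl_def PiE_def extensional_def)
      qed
    qed auto
    have yz: "y u = z u" if "u \<in> W" for u
      using that W y by (auto simp: cyl_def subset_eq)
    have "cyl (insert v W) y = {x \<in> cyl W z. z(v := x v) = y}"
      unfolding eq using yz by (auto simp: cyl_def)
    then show "marg q (insert v W) y = sum q {x \<in> cyl W z. z(v := x v) = y}" by (simp add: marg_def)
  qed
  also have "\<dots> = marg q W z"
    unfolding marg_def
  proof (intro sum.group finite_cyl image_subsetI)
    fix x assume "x \<in> cyl W z"
    then have "z(v := x v) \<in> \<Omega>" using v z by (intro update_in_\<Omega>) (auto simp: cyl_def PiE_mem)
    then show "z(v := x v) \<in> cyl (V - {v}) z" by (simp add: cyl_def)
  qed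
  finally show ?thesis .
qed

text \<open>Here the value at \<open>v\<close> stays fixed and the sites outside
  \<open>insert v U\<close> vary; overwriting the value at \<open>v\<close> by \<open>x v\<close>
  sorts the cylinder over \<open>U\<close> by its configuration off \<open>v\<close>.\<close>

lemma sum_marg_cyl_insert:
  assumes v: "v \<in> V" and U: "U \<subseteq> V - {v}" and x: "x \<in> \<Omega>"
  shows "(\<Sum>z\<in>cyl (insert v U) x. marg q (V - {v}) z) = marg q U x"
proof -
  have "(\<Sum>z\<in>cyl (insert v U) x. marg q (V - {v}) z) = (\<Sum>z\<in>cyl (insert v U) x. sum q {w \<in> cyl U x. w(v := x v) = z})"
  proof (intro sum.cong refl)
    fix z assume z: "z \<in> cyl (insert v U) x"
    have "cyl (V - {v}) z = {w \<in> cyl U x. w(v := x v) = z}"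
    proof (intro equalityI subsetI)
      fix w assume w: "w \<in> cyl (V - {v}) z"
      have "w(v := x v) = z"
      proof
        fix u show "(w(v := x v)) u = z u"
          using z w by (cases "u \<in> V") (auto simp: cyl_def PiE_def extensional_def)
      qed
      moreover have "w u = x u" if "u \<in> U" for u
        using that U w z by (auto simp: cyl_def subset_eq)
      ultimately show "w \<in> {w \<in> cyl U x. w(v := x v) = z}"
        using w by (auto simp: cyl_def)
    qed (auto simp: cyl_def split: if_splits)
    then show "marg q (V - {v}) z = sum q {w \<in> cyl U x. w(v := x v) = z}" by (simp add: marg_def)
  qed
  also have "\<dots> = marg q U x"
    unfolding marg_def
  proof (intro sum.group finite_cyl image_subsetI)
    fix w assume "w \<in> cyl U x"
    then have "w(v := x v) \<in> \<Omega>" using v x by (intro update_in_\<Omega>) (auto simp: cyl_def PiE_mem)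
    then show "w(v := x v) \<in> cyl (insert v U) x" using \<open>w \<in> cyl U x\<close> by (simp add: cyl_def)
  qed
  finally show ?thesis .
qed

end

section \<open>The Markov property as a product identity\<close>

locale configuration_distribution = finite_configurations V A
  for V :: "nat set" and A :: "'a set" +
  fixes p :: "(nat \<Rightarrow> 'a) \<Rightarrow> real"
  assumes p_nonneg: "\<And>y. y \<in> \<Omega> \<Longrightarrow> 0 \<le> p y" and p_sum: "sum p \<Omega> = 1"
begin

lemma marg_p_pos: "y \<in> \<Omega> \<Longrightarrow> 0 < p y \<Longrightarrow> 0 < marg p W y"
  using le_marg[of p y W] p_nonneg by fastforce

lemma marg_p_eq_0: "marg p W y = 0 \<Longrightarrow> W \<subseteq> U \<Longrightarrow> marg p U y = 0"
  using marg_antimono[of p W U y, OF p_nonneg] marg_nonneg[of p U y, OF p_nonneg] by linarith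

text \<open>The Markov property of \<open>W\<close> at \<open>v\<close> in product form, free of conditioning.\<close>

definition screens :: "nat \<Rightarrow> nat set \<Rightarrow> bool" where
  "screens v W \<longleftrightarrow> W \<subseteq> V - {v} \<and>
    (\<forall>x\<in>\<Omega>. p x * marg p W x = marg p (V - {v}) x * marg p (insert v W) x)"

text \<open>The defining identity of \<open>screens\<close> is summed over the sites outside
  \<open>insert v U\<close>; the marginals on \<open>W\<close> and \<open>insert v W\<close> are
  constant along the sum.\<close>

lemma screens_product:
  assumes "screens v W" "v \<in> V" "W \<subseteq> U" "U \<subseteq> V - {v}" "x \<in> \<Omega>"
  shows "marg p (insert v U) x * marg p W x = marg p U x * marg p (insert v W) x"
proof -
  have "marg p (insert v U) x * marg p W x = (\<Sum>z\<in>cyl (insert v U) x. p z * marg p W x)"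
    by (simp add: marg_def[of p "insert v U"] sum_distrib_right)
  also have "\<dots> = (\<Sum>z\<in>cyl (insert v U) x. marg p (V - {v}) z * marg p (insert v W) x)"
  proof (intro sum.cong refl)
    fix z assume z: "z \<in> cyl (insert v U) x"
    have "marg p W z = marg p W x" "marg p (insert v W) z = marg p (insert v W) x"
      using z assms(3) by (auto intro!: marg_cong simp: cyl_def)
    then show "p z * marg p W x = marg p (V - {v}) z * marg p (insert v W) x"
      using assms(1) z unfolding screens_def by (auto simp: cyl_def)
  qed
  also have "\<dots> = marg p U x * marg p (insert v W) x"
    using sum_marg_cyl_insert[OF assms(2,4,5)] by (simp flip: sum_distrib_right)
  finally show ?thesis .
qed

text \<open>The identities for \<open>V - {v}\<close> and for \<open>U\<close> both involve the
  conditional law given \<open>W\<close>; eliminating it relates \<open>V - {v}\<close> to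
  \<open>U\<close> directly, and a vanishing \<open>W\<close> marginal makes both sides 0.\<close>

lemma screens_superset:
  assumes "screens v W" "v \<in> V" "W \<subseteq> U" "U \<subseteq> V - {v}"
  shows "screens v U"
  unfolding screens_def
proof (intro conjI ballI)
  fix x assume x: "x \<in> \<Omega>"
  have W: "p x * marg p W x = marg p (V - {v}) x * marg p (insert v W) x"
    using assms x by (auto simp: screens_def)
  have U: "marg p (insert v U) x * marg p W x = marg p U x * marg p (insert v W) x"
    by (rule screens_product[OF assms x])
  show "p x * marg p U x = marg p (V - {v}) x * marg p (insert v U) x"
  proof (cases "marg p W x = 0")
    case True
    then have "marg p U x = 0" "marg p (insert v U) x = 0"
      using assms(3) by (auto intro: marg_p_eq_0)
    then show ?thesis by simp
  next
    case False
    have "(p x * marg p U x) * marg p W x = marg p (V - {v}) x * (marg p U x * marg p (insert v W) x)"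
      using W by (simp add: mult_ac)
    also have "\<dots> = (marg p (V - {v}) x * marg p (insert v U) x) * marg p W x"
      unfolding U[symmetric] by (simp add: mult_ac)
    finally show ?thesis using False by simp
  qed
qed (use assms in auto)

text \<open>For this maximal set without \<open>v\<close> and \<open>w\<close> the product identity
  involves the marginals on \<open>V - {v}\<close> and \<open>V - {w}\<close> symmetrically. This is
  the source of the symmetry of the dependency graph.\<close>

lemma screens_sym:
  assumes "screens v (V - {v, w})" "v \<in> V" "w \<in> V" "v \<noteq> w"
  shows "screens w (V - {v, w})"
proof -
  have "insert v (V - {v, w}) = V - {w}" "insert w (V - {v, w}) = V - {v}"
    using assms by auto
  then show ?thesis using assms unfolding screens_def by (auto simp: mult.commute)
qed

definition log_cond :: "nat \<Rightarrow> nat set \<Rightarrow> (nat \<Rightarrow> 'a) \<Rightarrow> real" where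
  "log_cond v W y = ln (marg p (insert v W) y / marg p W y)"

lemma log_cond_screens:
  assumes "screens v W" "v \<in> V" "y \<in> \<Omega>" "0 < p y"
  shows "log_cond v W y = log_cond v (V - {v}) y"
proof -
  have "insert v (V - {v}) = V" using assms by auto
  moreover have "p y * marg p W y = marg p (V - {v}) y * marg p (insert v W) y"
    using assms by (auto simp: screens_def)
  then have "marg p (insert v W) y / marg p W y = p y / marg p (V - {v}) y"
    using marg_p_pos[OF assms(3,4), of W] marg_p_pos[OF assms(3,4), of "V - {v}"] by (simp add: field_simps)
  ultimately show ?thesis using marg_V[OF assms(3)] by (simp add: log_cond_def)
qed

text \<open>In the equality case of Gibbs' inequality the
  product identity also holds off the support of \<open>p\<close>, since there the summands of the bounding sum
  that the inequality discards must vanish.\<close>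

lemma expected_log_cond_less:
  assumes v: "v \<in> V" and W: "W \<subseteq> V - {v}" and ns: "\<not> screens v W"
  shows "(\<Sum>y\<in>\<Omega>. p y * log_cond v W y) < (\<Sum>y\<in>\<Omega>. p y * log_cond v (V - {v}) y)"
proof -
  define R where "R = V - {v}"
  have insR: "insert v R = V" using v by (auto simp: R_def)
  \<comment> \<open>\<open>e\<close> follows \<open>p\<close> off \<open>v\<close> and takes the
    value at \<open>v\<close> from the conditional law given \<open>W\<close> only. Gibbs'
    inequality compares \<open>e\<close> with \<open>p\<close>, and \<open>D\<close> is its
    pointwise nonnegative gap.\<close>
  define e where "e y = marg p R y * (marg p (insert v W) y / marg p W y)" for y
  define D where "D y = e y - p y - p y * (log_cond v W y - log_cond v R y)" for y
  have pos: "0 < marg p U y" if "y \<in> \<Omega>" "0 < p y" for U y using marg_p_pos that by blast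
  have nn: "0 \<le> marg p U y" for U y using marg_nonneg p_nonneg by blast
  have D_alt: "D y = p y * (e y / p y - 1 - ln (e y / p y))" "0 < e y / p y" if y: "y \<in> \<Omega>" "0 < p y" for y
  proof -
    have e: "0 < e y" using pos[OF y] by (simp add: e_def)
    then show "0 < e y / p y" using y by simp
    have "log_cond v W y - log_cond v R y = ln ((marg p (insert v W) y / marg p W y) / (p y / marg p R y))"
      unfolding log_cond_def insR marg_V[OF y(1)] using pos[OF y] y by (intro ln_divide_pos [symmetric] divide_pos_pos)
    also have "(marg p (insert v W) y / marg p W y) / (p y / marg p R y) = e y / p y"
      by (simp add: e_def)
    finally show "D y = p y * (e y / p y - 1 - ln (e y / p y))"
      using y by (simp add: D_def field_simps)
  qed
  have D_nonneg: "0 \<le> D y" if y: "y \<in> \<Omega>" for y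
  proof (cases "p y = 0")
    case True then show ?thesis by (simp add: D_def e_def nn)
  next
    case False
    then have p: "0 < p y" using p_nonneg[OF y] by simp
    show ?thesis using D_alt[OF y p] ln_le_minus_one[of "e y / p y"] p by simp
  qed
  have sum_e: "sum e \<Omega> \<le> 1"
  proof -
    \<comment> \<open>After expanding the marginal on \<open>R\<close> over \<open>z\<close>, the
      inner sum runs over the updates of \<open>z\<close> at \<open>v\<close>, where the conditional
      probabilities add up to 1, or to 0 if the conditioning event is null.\<close>
    have "sum e \<Omega> = (\<Sum>y\<in>\<Omega>. \<Sum>z\<in>\<Omega>. of_bool (\<forall>u\<in>R. z u = y u) * p z * (marg p (insert v W) y / marg p W y))"
      unfolding e_def marg_eq_sum[of p R] sum_distrib_right ..
    also have "\<dots> = (\<Sum>z\<in>\<Omega>. \<Sum>y\<in>\<Omega>. of_bool (\<forall>u\<in>R. z u = y u) * p z * (marg p (insert v W) y / marg p W y))"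
      by (rule sum.swap)
    also have "\<dots> \<le> (\<Sum>z\<in>\<Omega>. p z)"
    proof (rule sum_mono)
      fix z assume z: "z \<in> \<Omega>"
      have "(\<Sum>y\<in>\<Omega>. of_bool (\<forall>u\<in>R. z u = y u) * p z * (marg p (insert v W) y / marg p W y))
          = (\<Sum>y\<in>cyl R z. p z * (marg p (insert v W) y / marg p W z))"
      proof (intro sum.mono_neutral_cong_right finite_\<Omega> cyl_subset ballI)
        fix y assume "y \<in> cyl R z"
        then have "marg p W y = marg p W z" using W by (intro marg_cong) (auto simp: cyl_def R_def)
        then show "of_bool (\<forall>u\<in>R. z u = y u) * p z * (marg p (insert v W) y / marg p W y)
            = p z * (marg p (insert v W) y / marg p W z)"
          using \<open>y \<in> cyl R z\<close> by (simp add: cyl_def)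
      qed (auto simp: cyl_def)
      also have "\<dots> = p z * (marg p W z / marg p W z)"
        using sum_marg_cyl_update[OF v W z, of p]
        by (simp add: R_def sum_distrib_left [symmetric] sum_divide_distrib [symmetric])
      also have "\<dots> \<le> p z" using p_nonneg[OF z] by (cases "marg p W z = 0") auto
      finally show "(\<Sum>y\<in>\<Omega>. of_bool (\<forall>u\<in>R. z u = y u) * p z * (marg p (insert v W) y / marg p W y)) \<le> p z" .
    qed
    finally show ?thesis by (simp add: p_sum)
  qed
  have "sum D \<Omega> = sum e \<Omega> - 1 - ((\<Sum>y\<in>\<Omega>. p y * log_cond v W y) - (\<Sum>y\<in>\<Omega>. p y * log_cond v R y))"
    by (simp add: D_def sum_subtractf right_diff_distrib p_sum)
  then have le: "sum D \<Omega> \<le> (\<Sum>y\<in>\<Omega>. p y * log_cond v R y) - (\<Sum>y\<in>\<Omega>. p y * log_cond v W y)"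
    using sum_e by simp
  have "0 < sum D \<Omega>"
  proof (rule ccontr)
    assume "\<not> 0 < sum D \<Omega>"
    then have "sum D \<Omega> = 0" using D_nonneg sum_nonneg[of \<Omega> D] by fastforce
    then have D0: "D y = 0" if "y \<in> \<Omega>" for y
      using sum_nonneg_eq_0_iff[OF finite_\<Omega>, of D] D_nonneg that by blast
    have "p y * marg p W y = marg p R y * marg p (insert v W) y" if y: "y \<in> \<Omega>" for y
    proof (cases "p y = 0")
      case True
      then have "e y = 0" using D0[OF y] by (simp add: D_def)
      \<comment> \<open>\<open>e y = 0\<close> can also result from a zero denominator; then the
        marginal on the larger set \<open>R\<close> vanishes too.\<close>
      moreover have "marg p R y = 0" if "marg p W y = 0"
        using marg_p_eq_0[OF that, of R] W by (simp add: R_def)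
      ultimately show ?thesis using True by (auto simp: e_def)
    next
      case False
      then have p: "0 < p y" using p_nonneg[OF y] by simp
      have "ln (e y / p y) = e y / p y - 1" using D0[OF y] D_alt(1)[OF y p] p by simp
      then have "e y / p y = 1" using ln_eq_minus_one D_alt(2)[OF y p] by blast
      then have "e y = p y" using p by simp
      then show ?thesis using pos[OF y p, of W] by (simp add: e_def field_simps)
    qed
    then show False using ns W by (simp add: screens_def R_def)
  qed
  then show ?thesis using le by (simp add: R_def)
qed

end

section \<open>Neighborhood scores\<close>

text \<open>Models one fixed sample path, \<open>c n y\<close> being the number of occurrences of
  \<open>y\<close> among the first \<open>n\<close> observations; the comparison of neighborhoods
  thereby becomes deterministic.\<close>

locale converging_counts = configuration_distribution V A p
  for V :: "nat set" and A :: "'a set" and p :: "(nat \<Rightarrow> 'a) \<Rightarrow> real" +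
  fixes c :: "nat \<Rightarrow> (nat \<Rightarrow> 'a) \<Rightarrow> real"
  assumes c_nonneg: "\<And>n y. y \<in> \<Omega> \<Longrightarrow> 0 \<le> c n y"
    and c_sum: "\<And>n. sum (c n) \<Omega> = real n"
    and c_support: "\<And>n y. y \<in> \<Omega> \<Longrightarrow> p y = 0 \<Longrightarrow> c n y = 0"
    and c_limit: "\<And>y. y \<in> \<Omega> \<Longrightarrow> (\<lambda>n. (c n y - real n * p y)\<^sup>2 / (real n * ln (real n))) \<longlonglongrightarrow> 0"
begin

text \<open>\<open>n\<close> times the relative entropy of the empirical law on \<open>W\<close>
  with respect to the marginal of \<open>p\<close>, written over full configurations.\<close>

definition KL :: "nat \<Rightarrow> nat set \<Rightarrow> real" where
  "KL n W = (\<Sum>y\<in>\<Omega>. c n y * ln (marg (c n) W y / (real n * marg p W y)))"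

text \<open>\<open>n\<close> times the l1 distance between the empirical law and \<open>p\<close>; a
  single quantity bounding the deviations of all marginals.\<close>

definition \<tau> :: "nat \<Rightarrow> real" where
  "\<tau> n = (\<Sum>y\<in>\<Omega>. \<bar>c n y - real n * p y\<bar>)"

lemma \<tau>_nonneg: "0 \<le> \<tau> n" by (simp add: \<tau>_def sum_nonneg)

lemma \<tau>_limit: "(\<lambda>n. (\<tau> n)\<^sup>2 / (real n * ln (real n))) \<longlonglongrightarrow> 0"
proof -
  have "(\<lambda>n. sqrt ((c n y - real n * p y)\<^sup>2 / (real n * ln (real n)))) \<longlonglongrightarrow> sqrt 0" if "y \<in> \<Omega>" for y
    by (intro tendsto_real_sqrt c_limit that)
  then have "(\<lambda>n. (\<Sum>y\<in>\<Omega>. \<bar>c n y - real n * p y\<bar> / sqrt (real n * ln (real n)))\<^sup>2) \<longlonglongrightarrow> (\<Sum>y\<in>\<Omega>. 0)\<^sup>2"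
    by (intro tendsto_power tendsto_sum) (simp add: real_sqrt_divide)
  then have "(\<lambda>n. (\<tau> n / sqrt (real n * ln (real n)))\<^sup>2) \<longlonglongrightarrow> 0"
    by (simp add: \<tau>_def sum_divide_distrib)
  moreover have "\<forall>\<^sub>F n in sequentially. (\<tau> n / sqrt (real n * ln (real n)))\<^sup>2 = (\<tau> n)\<^sup>2 / (real n * ln (real n))"
    using eventually_ge_at_top[of 2]
  proof eventually_elim
    case (elim n)
    then have "0 \<le> real n * ln (real n)" by simp
    then show ?case by (simp only: power_divide real_sqrt_pow2)
  qed
  ultimately show ?thesis by (rule Lim_transform_eventually)
qed

lemma marg_diff_le_\<tau>: "\<bar>marg (c n) W y - real n * marg p W y\<bar> \<le> \<tau> n"
proof -
  have "marg (c n) W y - real n * marg p W y = (\<Sum>z\<in>cyl W y. c n z - real n * p z)"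
    by (simp add: marg_def sum_subtractf sum_distrib_left)
  also have "\<bar>\<dots>\<bar> \<le> (\<Sum>z\<in>cyl W y. \<bar>c n z - real n * p z\<bar>)" by (rule sum_abs)
  also have "\<dots> \<le> \<tau> n" unfolding \<tau>_def by (intro sum_mono2 finite_\<Omega> cyl_subset) auto
  finally show ?thesis .
qed

lemma c_pos_imp: "y \<in> \<Omega> \<Longrightarrow> 0 < c n y \<Longrightarrow> 0 < p y \<and> 0 < marg (c n) W y \<and> 0 < marg p W y"
  using c_support[of y n] p_nonneg[of y] le_marg[of "c n" y W, OF c_nonneg] marg_p_pos[of y W]
  by (cases "p y = 0") auto

text \<open>Termwise \<open>ln r \<ge> 1 - 1 / r\<close>. The lower bounds sum to a nonnegative
  number because \<open>marg_swap\<close> turns the subtracted sum into one dominated by the total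
  mass of \<open>p\<close>.\<close>

lemma KL_nonneg:
  assumes n: "1 \<le> n"
  shows "0 \<le> KL n W"
proof -
  have "(\<Sum>y\<in>\<Omega>. c n y * (1 / marg (c n) W y) * marg p W y) = (\<Sum>y\<in>\<Omega>. p y * (1 / marg (c n) W y) * marg (c n) W y)"
    by (rule marg_swap) (metis marg_cong)
  also have "\<dots> \<le> sum p \<Omega>"
    using p_nonneg by (intro sum_mono) (auto simp: divide_simps)
  finally have le: "(\<Sum>y\<in>\<Omega>. c n y * (1 / marg (c n) W y) * marg p W y) \<le> 1" by (simp add: p_sum)
  have "0 \<le> real n - real n * (\<Sum>y\<in>\<Omega>. c n y * (1 / marg (c n) W y) * marg p W y)"
    using mult_left_mono[OF le, of "real n"] by simp
  also have "\<dots> = (\<Sum>y\<in>\<Omega>. c n y - real n * (c n y * (1 / marg (c n) W y) * marg p W y))"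
    by (simp add: sum_subtractf sum_distrib_left c_sum)
  also have "\<dots> \<le> KL n W"
    unfolding KL_def
  proof (rule sum_mono)
    fix y assume y: "y \<in> \<Omega>"
    show "c n y - real n * (c n y * (1 / marg (c n) W y) * marg p W y)
        \<le> c n y * ln (marg (c n) W y / (real n * marg p W y))"
    proof (cases "c n y = 0")
      case False
      then have c: "0 < c n y" using c_nonneg[OF y, of n] by simp
      define r where "r = marg (c n) W y / (real n * marg p W y)"
      have "0 < r" using c_pos_imp[OF y c, of W] n by (simp add: r_def)
      then have "1 - 1 / r \<le> ln r" using ln_le_minus_one[of "1 / r"] by (simp add: ln_div)
      then have "c n y * (1 - 1 / r) \<le> c n y * ln r" using c by simp
      then show ?thesis by (simp add: r_def right_diff_distrib mult_ac)
    qed simp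
  qed
  finally show ?thesis .
qed

text \<open>With \<open>ln r \<le> r - 1\<close> this is bounded by the \<open>\<chi>\<^sup>2\<close> statistic of \<open>W\<close>.\<close>

lemma KL_le:
  assumes n: "1 \<le> n"
  shows "KL n W \<le> (\<tau> n)\<^sup>2 / real n * (\<Sum>y\<in>\<Omega>. 1 / p y)"
proof -
  define t where "t y = c n y - real n * p y" for y
  have mt: "marg t W y = marg (c n) W y - real n * marg p W y" for y
    by (simp add: marg_def t_def sum_subtractf sum_distrib_left)
  \<comment> \<open>With \<open>c n y = n * p y + t y\<close>, the linear part sums to the total of
    \<open>t\<close> by \<open>marg_swap\<close>, hence to 0, and only the part quadratic in
    \<open>t\<close> remains.\<close>
  have "KL n W \<le> (\<Sum>y\<in>\<Omega>. p y * (1 / marg p W y) * marg t W y + t y * marg t W y / (real n * marg p W y))"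
    unfolding KL_def
  proof (rule sum_mono)
    fix y assume y: "y \<in> \<Omega>"
    define r where "r = marg (c n) W y / (real n * marg p W y)"
    have "c n y * ln r \<le> c n y * (marg t W y / (real n * marg p W y))"
    proof (cases "c n y = 0")
      case False
      then have c: "0 < c n y" using c_nonneg[OF y, of n] by simp
      have "0 < r" using c_pos_imp[OF y c, of W] n by (simp add: r_def)
      then have "ln r \<le> r - 1" by (rule ln_le_minus_one)
      also have "r - 1 = marg t W y / (real n * marg p W y)"
        using c_pos_imp[OF y c, of W] n by (simp add: r_def mt diff_divide_distrib)
      finally show ?thesis using c by (intro mult_left_mono) auto
    qed simp
    also have "\<dots> = p y * (1 / marg p W y) * marg t W y + t y * marg t W y / (real n * marg p W y)"
      using n by (simp add: t_def field_simps diff_divide_distrib)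
    finally show "c n y * ln (marg (c n) W y / (real n * marg p W y))
        \<le> p y * (1 / marg p W y) * marg t W y + t y * marg t W y / (real n * marg p W y)"
      by (simp add: r_def)
  qed
  also have "\<dots> = (\<Sum>y\<in>\<Omega>. p y * (1 / marg p W y) * marg t W y) + (\<Sum>y\<in>\<Omega>. t y * marg t W y / (real n * marg p W y))"
    by (rule sum.distrib)
  also have "(\<Sum>y\<in>\<Omega>. p y * (1 / marg p W y) * marg t W y) = (\<Sum>y\<in>\<Omega>. t y * (1 / marg p W y) * marg p W y)"
    by (rule marg_swap) (metis marg_cong)
  also have "\<dots> = sum t \<Omega>"
  proof (intro sum.cong refl)
    fix y assume y: "y \<in> \<Omega>"
    show "t y * (1 / marg p W y) * marg p W y = t y"
    proof (cases "p y = 0")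
      case True
      then show ?thesis using c_support[OF y True] by (simp add: t_def)
    next
      case False
      then show ?thesis using marg_p_pos[OF y, of W] p_nonneg[OF y] by simp
    qed
  qed
  also have "sum t \<Omega> = 0"
    by (simp add: t_def sum_subtractf sum_distrib_left [symmetric] c_sum p_sum)
  also have "(\<Sum>y\<in>\<Omega>. t y * marg t W y / (real n * marg p W y)) \<le> (\<Sum>y\<in>\<Omega>. (\<tau> n)\<^sup>2 / real n * (1 / p y))"
  proof (rule sum_mono)
    fix y assume y: "y \<in> \<Omega>"
    show "t y * marg t W y / (real n * marg p W y) \<le> (\<tau> n)\<^sup>2 / real n * (1 / p y)"
    proof (cases "p y = 0")
      \<comment> \<open>Off the support \<open>t y = 0\<close>, and \<open>1 / p y\<close> is 0 by
        convention.\<close>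
      case True
      then show ?thesis using c_support[OF y True] by (simp add: t_def)
    next
      case False
      then have p: "0 < p y" using p_nonneg[OF y] by simp
      have "\<bar>t y\<bar> \<le> \<tau> n" unfolding \<tau>_def t_def using y finite_\<Omega>
        by (intro member_le_sum[where f = "\<lambda>y. \<bar>c n y - real n * p y\<bar>"]) auto
      moreover have "\<bar>marg t W y\<bar> \<le> \<tau> n" unfolding mt by (rule marg_diff_le_\<tau>)
      ultimately have "\<bar>t y * marg t W y\<bar> \<le> \<tau> n * \<tau> n"
        unfolding abs_mult by (intro mult_mono \<tau>_nonneg) auto
      then have "t y * marg t W y \<le> (\<tau> n)\<^sup>2" by (simp add: power2_eq_square)
      then have "t y * marg t W y / (real n * marg p W y) \<le> (\<tau> n)\<^sup>2 / (real n * marg p W y)"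
        using marg_p_pos[OF y p, of W] by (intro divide_right_mono) auto
      also have "\<dots> \<le> (\<tau> n)\<^sup>2 / (real n * p y)"
        using le_marg[of p y W] p_nonneg y p n by (intro divide_left_mono mult_left_mono mult_pos_pos marg_p_pos) auto
      finally show ?thesis by simp
    qed
  qed
  also have "\<dots> = (\<tau> n)\<^sup>2 / real n * (\<Sum>y\<in>\<Omega>. 1 / p y)" by (simp only: sum_distrib_left)
  finally show ?thesis by simp
qed

lemma KL_over_ln_limit: "(\<lambda>n. KL n W / ln (real n)) \<longlonglongrightarrow> 0"
proof (rule tendsto_sandwich[OF _ _ tendsto_const])
  have "(\<lambda>n. (\<tau> n)\<^sup>2 / (real n * ln (real n)) * (\<Sum>y\<in>\<Omega>. 1 / p y)) \<longlonglongrightarrow> 0 * (\<Sum>y\<in>\<Omega>. 1 / p y)"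
    by (intro tendsto_mult \<tau>_limit tendsto_const)
  then show "(\<lambda>n. (\<tau> n)\<^sup>2 / (real n * ln (real n)) * (\<Sum>y\<in>\<Omega>. 1 / p y)) \<longlonglongrightarrow> 0" by simp
  show "\<forall>\<^sub>F n in sequentially. 0 \<le> KL n W / ln (real n)"
    using eventually_ge_at_top[of 1] by eventually_elim (simp add: KL_nonneg)
  show "\<forall>\<^sub>F n in sequentially. KL n W / ln (real n) \<le> (\<tau> n)\<^sup>2 / (real n * ln (real n)) * (\<Sum>y\<in>\<Omega>. 1 / p y)"
    using eventually_ge_at_top[of 2]
  proof eventually_elim
    case (elim n)
    have "KL n W / ln (real n) \<le> ((\<tau> n)\<^sup>2 / real n * (\<Sum>y\<in>\<Omega>. 1 / p y)) / ln (real n)"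
      using elim by (intro divide_right_mono KL_le) auto
    then show ?case by simp
  qed
qed

section \<open>Scores of competing neighborhoods\<close>

definition loglik :: "nat \<Rightarrow> nat \<Rightarrow> nat set \<Rightarrow> real" where
  "loglik n v W = (\<Sum>y\<in>\<Omega>. c n y * ln (marg (c n) (insert v W) y / marg (c n) W y))"

lemma loglik_eq:
  assumes n: "1 \<le> n"
  shows "loglik n v W = (\<Sum>y\<in>\<Omega>. c n y * log_cond v W y) + KL n (insert v W) - KL n W"
proof -
  have "c n y * ln (marg (c n) (insert v W) y / marg (c n) W y)
      = c n y * log_cond v W y + c n y * ln (marg (c n) (insert v W) y / (real n * marg p (insert v W) y))
        - c n y * ln (marg (c n) W y / (real n * marg p W y))" if y: "y \<in> \<Omega>" for y
  proof (cases "c n y = 0")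
    case False
    then have c: "0 < c n y" using c_nonneg[OF y, of n] by simp
    show ?thesis
      using c_pos_imp[OF y c, of W] c_pos_imp[OF y c, of "insert v W"] n
      by (simp add: log_cond_def ln_divide_pos ln_mult_pos right_diff_distrib distrib_left)
  qed simp
  then show ?thesis
    by (simp add: loglik_def KL_def sum.distrib [symmetric] sum_subtractf [symmetric])
qed

definition score :: "real \<Rightarrow> nat \<Rightarrow> nat \<Rightarrow> nat set \<Rightarrow> real" where
  "score \<kappa> n v W = loglik n v W - \<kappa> * ln (real n) * real (card A ^ card W)"

text \<open>Both sets give the same conditional law on the support, so the mean terms cancel
  exactly. Four entropies of order \<open>o(ln n)\<close> remain against a penalty gap
  \<open>\<delta> * ln n\<close>, where \<open>\<delta>\<close> is positive because
  \<open>card A\<close> is at least 2.\<close>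

lemma score_overfit:
  assumes "screens v W1" "screens v W2" "v \<in> V" "W1 \<subset> W2" "0 < \<kappa>" "2 \<le> card A"
  shows "\<forall>\<^sub>F n in sequentially. score \<kappa> n v W2 < score \<kappa> n v W1"
proof -
  define \<delta> where "\<delta> = \<kappa> * (real (card A ^ card W2) - real (card A ^ card W1))"
  have "finite W2" using assms(2) finite_V by (auto simp: screens_def intro: finite_subset)
  then have "card W1 < card W2" using assms(4) by (simp add: psubset_card_mono)
  then have "card A ^ card W1 < card A ^ card W2" using assms(6) by (intro power_strict_increasing) auto
  then have \<delta>: "0 < \<delta>" using assms(5) unfolding \<delta>_def by (intro mult_pos_pos) (simp_all flip: of_nat_power)
  let ?k = "\<lambda>n W. KL n W / ln (real n)"
  have "(\<lambda>n. ?k n (insert v W2) - ?k n W2 - (?k n (insert v W1) - ?k n W1) - \<delta>) \<longlonglongrightarrow> 0 - 0 - (0 - 0) - \<delta>"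
    by (intro tendsto_diff KL_over_ln_limit tendsto_const)
  then have "\<forall>\<^sub>F n in sequentially. ?k n (insert v W2) - ?k n W2 - (?k n (insert v W1) - ?k n W1) - \<delta> < 0"
    by (rule order_tendstoD) (use \<delta> in simp)
  with eventually_ge_at_top[of 2] show ?thesis
  proof eventually_elim
    case (elim n)
    have eq: "(\<Sum>y\<in>\<Omega>. c n y * log_cond v W2 y) = (\<Sum>y\<in>\<Omega>. c n y * log_cond v W1 y)"
    proof (intro sum.cong refl)
      fix y assume y: "y \<in> \<Omega>"
      show "c n y * log_cond v W2 y = c n y * log_cond v W1 y"
      proof (cases "p y = 0")
        case False
        then have "0 < p y" using p_nonneg[OF y] by simp
        then show ?thesis using assms y by (simp add: log_cond_screens)
      qed (simp add: c_support[OF y])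
    qed
    have ln: "0 < ln (real n)" using elim by simp
    have "score \<kappa> n v W2 - score \<kappa> n v W1
        = KL n (insert v W2) - KL n W2 - (KL n (insert v W1) - KL n W1) - ln (real n) * \<delta>"
      using elim by (simp add: score_def loglik_eq eq \<delta>_def algebra_simps)
    also have "\<dots> = ln (real n) * (?k n (insert v W2) - ?k n W2 - (?k n (insert v W1) - ?k n W1) - \<delta>)"
      using ln by (simp add: right_diff_distrib)
    also have "\<dots> < 0" using ln elim(2) by (intro mult_pos_neg)
    finally show ?case by simp
  qed
qed

lemma frequency_limit:
  assumes "y \<in> \<Omega>"
  shows "(\<lambda>n. c n y / real n) \<longlonglongrightarrow> p y"
proof -
  have "(\<lambda>n. (c n y - real n * p y)\<^sup>2 / (real n * ln (real n)) * (ln (real n) / real n)) \<longlonglongrightarrow> 0 * 0"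
    by (intro tendsto_mult c_limit assms) real_asymp
  moreover have "\<forall>\<^sub>F n in sequentially. (c n y - real n * p y)\<^sup>2 / (real n * ln (real n)) * (ln (real n) / real n)
      = (c n y / real n - p y)\<^sup>2"
    using eventually_ge_at_top[of 2]
  proof eventually_elim
    case (elim n)
    then have "0 < ln (real n)" "0 < real n" by auto
    moreover have "c n y / real n - p y = (c n y - real n * p y) / real n" using elim by (simp add: diff_divide_distrib)
    ultimately show ?case by (simp add: power_divide power2_eq_square)
  qed
  ultimately have "(\<lambda>n. (c n y / real n - p y)\<^sup>2) \<longlonglongrightarrow> 0 * 0" by (rule Lim_transform_eventually)
  then have "(\<lambda>n. sqrt ((c n y / real n - p y)\<^sup>2)) \<longlonglongrightarrow> sqrt (0 * 0)" by (rule tendsto_real_sqrt)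
  then have "(\<lambda>n. c n y / real n - p y) \<longlonglongrightarrow> 0" by (simp add: tendsto_rabs_zero_iff)
  then show ?thesis by (rule Lim_null[THEN iffD2])
qed

lemma score_rate:
  "(\<lambda>n. score \<kappa> n v W / real n) \<longlonglongrightarrow> (\<Sum>y\<in>\<Omega>. p y * log_cond v W y)"
proof -
  have ln: "(\<lambda>n. ln (real n) / real n) \<longlonglongrightarrow> 0" by real_asymp
  \<comment> \<open>The entropies are \<open>o(ln n)\<close>, so after division by \<open>n\<close>
    they vanish together with the penalty.\<close>
  let ?k = "\<lambda>n W. KL n W / ln (real n) * (ln (real n) / real n)"
  have "(\<lambda>n. (\<Sum>y\<in>\<Omega>. c n y / real n * log_cond v W y) + ?k n (insert v W) - ?k n W
        - \<kappa> * (ln (real n) / real n) * real (card A ^ card W))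
      \<longlonglongrightarrow> (\<Sum>y\<in>\<Omega>. p y * log_cond v W y) + 0 * 0 - 0 * 0 - \<kappa> * 0 * real (card A ^ card W)"
    by (intro tendsto_diff tendsto_add tendsto_mult tendsto_sum KL_over_ln_limit ln tendsto_const frequency_limit)
  moreover have "\<forall>\<^sub>F n in sequentially. (\<Sum>y\<in>\<Omega>. c n y / real n * log_cond v W y) + ?k n (insert v W) - ?k n W
        - \<kappa> * (ln (real n) / real n) * real (card A ^ card W) = score \<kappa> n v W / real n"
    using eventually_ge_at_top[of 2]
  proof eventually_elim
    case (elim n)
    then have "0 < ln (real n)" "0 < real n" by auto
    then show ?case using elim
      by (simp add: score_def loglik_eq diff_divide_distrib add_divide_distrib sum_divide_distrib)
  qed
  ultimately show ?thesis by (simp add: tendsto_cong)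
qed

text \<open>A screening set attains the expected log-likelihood of \<open>V - {v}\<close>, so the
  strict Gibbs inequality gives a score gap growing linearly in \<open>n\<close>.\<close>

lemma score_underfit:
  assumes "screens v W1" "\<not> screens v W2" "v \<in> V" "W2 \<subseteq> V - {v}"
  shows "\<forall>\<^sub>F n in sequentially. score \<kappa> n v W2 < score \<kappa> n v W1"
proof -
  have "(\<Sum>y\<in>\<Omega>. p y * log_cond v W2 y) < (\<Sum>y\<in>\<Omega>. p y * log_cond v (V - {v}) y)"
    by (rule expected_log_cond_less[OF assms(3,4,2)])
  also have "\<dots> = (\<Sum>y\<in>\<Omega>. p y * log_cond v W1 y)"
  proof (intro sum.cong refl)
    fix y assume y: "y \<in> \<Omega>"
    show "p y * log_cond v (V - {v}) y = p y * log_cond v W1 y"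
      using log_cond_screens[OF assms(1,3) y] p_nonneg[OF y] by (cases "p y = 0") auto
  qed
  finally have neg: "(\<Sum>y\<in>\<Omega>. p y * log_cond v W2 y) - (\<Sum>y\<in>\<Omega>. p y * log_cond v W1 y) < 0" by simp
  have "(\<lambda>n. score \<kappa> n v W2 / real n - score \<kappa> n v W1 / real n)
      \<longlonglongrightarrow> (\<Sum>y\<in>\<Omega>. p y * log_cond v W2 y) - (\<Sum>y\<in>\<Omega>. p y * log_cond v W1 y)"
    by (intro tendsto_diff score_rate)
  from order_tendstoD(2)[OF this neg] eventually_ge_at_top[of 1]
  show ?thesis
  proof eventually_elim
    case (elim n)
    then show ?case by (simp add: diff_divide_distrib [symmetric] divide_less_0_iff)
  qed
qed

end

section \<open>The graph estimator\<close>

locale random_configuration = finite_configurations V A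
  for V :: "nat set" and A :: "'a set" +
  fixes \<pi> :: "(nat \<Rightarrow> 'a) measure"
  assumes prob_space_\<pi>: "prob_space \<pi>" and sets_\<pi>: "sets \<pi> = Pow \<Omega>"
begin

section \<open>The law of one observation\<close>

definition p :: "(nat \<Rightarrow> 'a) \<Rightarrow> real" where "p z = measure \<pi> {z}"

lemma space_\<pi>: "space \<pi> = \<Omega>"
  using sets_eq_imp_space_eq[of \<pi> "count_space \<Omega>"] sets_\<pi> by simp

lemma measure_eq_sum: "E \<subseteq> \<Omega> \<Longrightarrow> measure \<pi> E = sum p E"
  unfolding p_def using sets_\<pi> finite_\<Omega> finite_subset[of E \<Omega>]
  by (intro finite_measure.finite_measure_eq_sum_singleton prob_space.finite_measure[OF prob_space_\<pi>]) auto

sublocale configuration_distribution V A p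
proof
  show "0 \<le> p y" for y by (simp add: p_def)
  show "sum p \<Omega> = 1"
    using measure_eq_sum[of \<Omega>] prob_space.prob_space[OF prob_space_\<pi>] by (simp add: space_\<pi>)
qed

lemma prob_restrict:
  assumes "y \<in> \<Omega>"
  shows "\<P>(x in \<pi>. restrict x U = restrict y U) = marg p U y"
proof -
  have "{x \<in> space \<pi>. restrict x U = restrict y U} = cyl U y"
    unfolding cyl_def space_\<pi> by (auto simp: fun_eq_iff restrict_def)
  then show ?thesis using measure_eq_sum[OF cyl_subset] by (simp add: marg_def)
qed

lemma cond_prob_restrict:
  assumes "y \<in> \<Omega>" "v \<notin> U"
  shows "\<P>(x in \<pi>. x v = y v \<bar> restrict x U = restrict y U) = marg p (insert v U) y / marg p U y"
proof -
  have "{x \<in> space \<pi>. x v = y v \<and> restrict x U = restrict y U} = {x \<in> space \<pi>. restrict x (insert v U) = restrict y (insert v U)}"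
    by (auto simp: fun_eq_iff restrict_def)
  then show ?thesis
    unfolding cond_prob_def using prob_restrict[OF assms(1)] by simp
qed

text \<open>The instance \<open>U = V - {v}\<close> of the Markov property becomes the product
  identity when denominators are cleared, null events making both sides 0. Conversely,
  \<open>screens_product\<close> gives every intermediate \<open>U\<close>.\<close>

lemma markov_neighborhood_iff_screens:
  assumes v: "v \<in> V"
  shows "markov_neighborhood V A \<pi> v W \<longleftrightarrow> screens v W"
proof
  assume M: "markov_neighborhood V A \<pi> v W"
  then have W: "W \<subseteq> V - {v}" by (simp add: markov_neighborhood_def)
  define R where "R = V - {v}"
  have insR: "insert v R = V" and vR: "v \<notin> R" and vW: "v \<notin> W" using v W by (auto simp: R_def)
  have "p x * marg p W x = marg p R x * marg p (insert v W) x" if x: "x \<in> \<Omega>" for x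
  proof (cases "marg p R x = 0")
    case True
    then show ?thesis using marg_p_eq_0[OF True, of V] insR marg_V[OF x] by auto
  next
    case False
    then have pos: "0 < marg p R x" using marg_nonneg[of p R x, OF p_nonneg] by simp
    then have posW: "0 < marg p W x"
      using marg_antimono[of p W R x, OF p_nonneg] W by (simp add: R_def)
    have "\<P>(y in \<pi>. y v = x v \<bar> restrict y R = restrict x R)
        = \<P>(y in \<pi>. y v = x v \<bar> restrict y W = restrict (restrict x R) W)"
      using M W x v pos prob_restrict[OF x, of R] unfolding markov_neighborhood_def
      by (elim conjE allE[of _ R] impE) (auto simp: R_def PiE_def Pi_def)
    also have "restrict (restrict x R) W = restrict x W"
      using W by (auto simp: R_def fun_eq_iff restrict_def)
    finally have "p x / marg p R x = marg p (insert v W) x / marg p W x"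
      unfolding cond_prob_restrict[OF x vR] cond_prob_restrict[OF x vW] insR marg_V[OF x] .
    then show ?thesis using pos posW by (simp add: field_simps)
  qed
  then show "screens v W" using W by (simp add: screens_def R_def)
next
  assume S: "screens v W"
  then have W: "W \<subseteq> V - {v}" by (simp add: screens_def)
  show "markov_neighborhood V A \<pi> v W"
    unfolding markov_neighborhood_def
  proof (intro conjI W allI impI ballI)
    fix U a b
    assume U: "W \<subseteq> U \<and> U \<subseteq> V - {v}" and a: "a \<in> A" and "b \<in> U \<rightarrow>\<^sub>E A"
      and pos: "0 < \<P>(x in \<pi>. restrict x U = b)"
    have "{x \<in> space \<pi>. restrict x U = b} \<noteq> {}"
    proof
      assume empty: "{x \<in> space \<pi>. restrict x U = b} = {}"
      show False using pos unfolding empty by simp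
    qed
    then obtain z where z: "z \<in> \<Omega>" "restrict z U = b" by (auto simp: space_\<pi>)
    \<comment> \<open>A full configuration showing \<open>a\<close> at \<open>v\<close> and
      \<open>b\<close> on \<open>U\<close> at once; the given value of \<open>z\<close> at
      \<open>v\<close> is overwritten.\<close>
    define y where "y = z(v := a)"
    have y: "y \<in> \<Omega>" "y v = a" unfolding y_def using z v a by (auto intro: update_in_\<Omega>)
    have "restrict y U = restrict z U" using U by (intro restrict_ext) (auto simp: y_def)
    then have yU: "restrict y U = b" using z by simp
    have yW: "restrict b W = restrict y W" using U by (simp add: yU [symmetric] Int_absorb1)
    have posU: "0 < marg p U y" using pos prob_restrict[OF y(1), of U] yU by simp
    then have posW: "0 < marg p W y" using marg_antimono[of p W U y, OF p_nonneg] U by auto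
    have "marg p (insert v U) y * marg p W y = marg p U y * marg p (insert v W) y"
      using screens_product[OF S v _ _ y(1)] U by blast
    then have "marg p (insert v U) y / marg p U y = marg p (insert v W) y / marg p W y"
      using posU posW by (simp add: field_simps)
    moreover have "v \<notin> U" "v \<notin> W" using U W by auto
    ultimately have "\<P>(x in \<pi>. x v = y v \<bar> restrict x U = restrict y U)
        = \<P>(x in \<pi>. x v = y v \<bar> restrict x W = restrict y W)"
      using cond_prob_restrict[OF y(1), of v] by simp
    then show "\<P>(x in \<pi>. x v = a \<bar> restrict x U = b) = \<P>(x in \<pi>. x v = a \<bar> restrict x W = restrict b W)"
      by (simp only: y(2) yU yW)
  qed
qed

lemma screens_max: "v \<in> V \<Longrightarrow> screens v (V - {v})"
  unfolding screens_def by (auto simp: marg_V insert_absorb)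

section \<open>Basic neighborhoods and the dependency graph\<close>

context
  assumes intersection: "markov_intersection_property V A \<pi>"
begin

text \<open>The screening sets form a finite nonempty family, so closure under pairwise intersection
  extends to the intersection of all of them.\<close>

lemma basic_neighborhood_screens:
  assumes v: "v \<in> V"
  shows "screens v (basic_neighborhood V A \<pi> v)"
proof -
  define F where "F = {W. screens v W}"
  have "F \<subseteq> Pow V" by (auto simp: F_def screens_def)
  then have "finite F" using finite_V by (auto intro: finite_subset)
  have inter: "screens v (W1 \<inter> W2)" if "screens v W1" "screens v W2" for W1 W2
    using intersection v that unfolding markov_intersection_property_def
    by (auto simp: markov_neighborhood_iff_screens)
  have "\<Inter> G \<in> F" if "finite G" "G \<noteq> {}" "G \<subseteq> F" for G
    using that by (induction rule: finite_ne_induct) (auto simp: F_def inter)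
  from this[OF \<open>finite F\<close> _ subset_refl] screens_max[OF v] have "\<Inter> F \<in> F"
    by (auto simp: F_def)
  then show ?thesis by (simp add: F_def basic_neighborhood_def markov_neighborhood_iff_screens[OF v])
qed

lemma basic_neighborhood_subset: "v \<in> V \<Longrightarrow> basic_neighborhood V A \<pi> v \<subseteq> V - {v}"
  using basic_neighborhood_screens by (auto simp: screens_def)

lemma basic_neighborhood_le: "v \<in> V \<Longrightarrow> screens v W \<Longrightarrow> basic_neighborhood V A \<pi> v \<subseteq> W"
  by (auto simp: basic_neighborhood_def markov_neighborhood_iff_screens)

text \<open>If \<open>v\<close> were missing, \<open>V - {w, v}\<close> would screen
  \<open>w\<close>, hence by \<open>screens_sym\<close> also \<open>v\<close>, and minimality would
  exclude \<open>w\<close> from the basic neighborhood of \<open>v\<close>.\<close>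

lemma basic_neighborhood_sym:
  assumes v: "v \<in> V" and w: "w \<in> V" and vw: "w \<in> basic_neighborhood V A \<pi> v"
  shows "v \<in> basic_neighborhood V A \<pi> w"
proof (rule ccontr)
  assume n: "v \<notin> basic_neighborhood V A \<pi> w"
  have ne: "v \<noteq> w" using vw basic_neighborhood_subset[OF v] by auto
  have "screens w (V - {w, v})"
    using n basic_neighborhood_subset[OF w]
    by (intro screens_superset[OF basic_neighborhood_screens[OF w] w]) auto
  then have "screens v (V - {w, v})" using v w ne by (intro screens_sym) auto
  then show False using basic_neighborhood_le[OF v] vw by blast
qed

text \<open>\<open>nbrs\<close> collects incoming edges while \<open>dependency_graph\<close>
  records outgoing ones; symmetry reconciles the two.\<close>

lemma nbrs_dependency_graph:
  assumes v: "v \<in> V"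
  shows "nbrs V (dependency_graph V A \<pi>) v = basic_neighborhood V A \<pi> v"
  using basic_neighborhood_subset[OF v] basic_neighborhood_sym[OF v] basic_neighborhood_sym[OF _ v] v
  unfolding nbrs_def dependency_graph_def by blast

lemma simple_graph_dependency_graph: "simple_graph V (dependency_graph V A \<pi>)"
  using basic_neighborhood_sym basic_neighborhood_subset
  unfolding simple_graph_def dependency_graph_def sym_def irrefl_def by blast

end

end

lemma simple_graph_eqI:
  assumes "simple_graph V G" "simple_graph V H" "\<And>v. v \<in> V \<Longrightarrow> nbrs V G v = nbrs V H v"
  shows "G = H"
proof -
  have "(u, v) \<in> G \<longleftrightarrow> (u, v) \<in> H" for u v
    using assms(1,2) assms(3)[of v] unfolding simple_graph_def nbrs_def by blast
  then show ?thesis by auto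
qed

lemma nbrs_subset: "simple_graph V G \<Longrightarrow> nbrs V G v \<subseteq> V - {v}"
  by (auto simp: simple_graph_def nbrs_def irrefl_def)

section \<open>From the sample to neighborhood scores\<close>

context finite_configurations
begin

lemma sum_over_sample:
  fixes f :: "(nat \<Rightarrow> 'a) \<Rightarrow> real" and x :: "nat \<Rightarrow> nat \<Rightarrow> 'a"
  assumes "\<And>i. i \<in> {1..n} \<Longrightarrow> x i \<in> \<Omega>" "B \<subseteq> \<Omega>"
  shows "(\<Sum>i\<in>{i\<in>{1..n}. x i \<in> B}. f (x i)) = (\<Sum>y\<in>B. real (card {i\<in>{1..n}. x i = y}) * f y)"
proof -
  have "finite B" using assms(2) finite_\<Omega> by (rule finite_subset)
  then have "(\<Sum>i\<in>{i\<in>{1..n}. x i \<in> B}. f (x i))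
      = (\<Sum>y\<in>B. \<Sum>i\<in>{i \<in> {i\<in>{1..n}. x i \<in> B}. x i = y}. f (x i))"
    by (intro sum.group [symmetric] finite_subset[of "{i\<in>{1..n}. x i \<in> B}" "{1..n}"]) auto
  also have "\<dots> = (\<Sum>y\<in>B. \<Sum>i\<in>{i\<in>{1..n}. x i = y}. f y)"
    by (intro sum.cong) auto
  finally show ?thesis by simp
qed

lemma emp_count_eq_marg:
  assumes "\<And>i. i \<in> {1..n} \<Longrightarrow> x i \<in> \<Omega>"
  shows "real (emp_count x n W (restrict y W)) = marg (\<lambda>y. real (card {i\<in>{1..n}. x i = y})) W y"
proof -
  have "{i\<in>{1..n}. restrict (x i) W = restrict y W} = {i\<in>{1..n}. x i \<in> cyl W y}"
    using assms by (auto simp: cyl_def fun_eq_iff restrict_def)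
  then have "real (emp_count x n W (restrict y W)) = (\<Sum>i\<in>{i\<in>{1..n}. x i \<in> cyl W y}. 1)"
    by (simp add: emp_count_def)
  also have "\<dots> = marg (\<lambda>y. real (card {i\<in>{1..n}. x i = y})) W y"
    using sum_over_sample[OF assms cyl_subset, where f = "\<lambda>_. 1"] by (simp add: marg_def)
  finally show ?thesis .
qed

end

context converging_counts
begin

text \<open>Grouping the observations by value decouples the objective over the sites; the sites
  remain linked only through the requirement that the neighborhoods form a graph.\<close>

lemma penalized_score_eq:
  assumes x: "\<And>i. i \<in> {1..n} \<Longrightarrow> x i \<in> \<Omega>" and n: "1 \<le> n"
    and c: "\<And>y. y \<in> \<Omega> \<Longrightarrow> c n y = real (card {i\<in>{1..n}. x i = y})"
  shows "penalized_score V A (\<kappa> * ln (real n)) x n G = (\<Sum>v\<in>V. score \<kappa> n v (nbrs V G v))"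
proof -
  have marg: "real (emp_count x n W (restrict y W)) = marg (c n) W y" for W y
  proof -
    have "real (emp_count x n W (restrict y W)) = marg (\<lambda>y. real (card {i\<in>{1..n}. x i = y})) W y"
      using x by (rule emp_count_eq_marg)
    also have "\<dots> = marg (c n) W y"
      unfolding marg_def by (intro sum.cong refl c [symmetric] subsetD [OF cyl_subset])
    finally show ?thesis .
  qed
  define h where "h v y = marg (c n) (insert v (nbrs V G v)) y / marg (c n) (nbrs V G v) y" for v y
  have ecp: "emp_cond_prob x n {v} (nbrs V G v) y = h v y" for v y
    using n by (simp add: emp_cond_prob_def emp_prob_def marg h_def)
  \<comment> \<open>At an observed configuration all empirical marginals are positive, so the
    logarithm of the product may be split.\<close>
  have pos: "0 < h v (x i)" if i: "i \<in> {1..n}" for i v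
  proof -
    have "i \<in> {j\<in>{1..n}. x j = x i}" using i by simp
    then have "0 < c n (x i)" using c[OF x[OF i]] by (auto simp: card_gt_0_iff)
    then show ?thesis using c_pos_imp[OF x[OF i]] by (simp add: h_def)
  qed
  have nz: "h v (x i) \<noteq> 0" if "i \<in> {1..n}" for i v
    using pos[OF that, of v] by simp
  have "ln (max_pseudo_likelihood V x n G) = (\<Sum>i\<in>{1..n}. ln (\<Prod>v\<in>V. h v (x i)))"
    unfolding max_pseudo_likelihood_def ecp using pos nz finite_V by (intro ln_prod) (auto intro!: prod_pos)
  also have "\<dots> = (\<Sum>i\<in>{1..n}. \<Sum>v\<in>V. ln (h v (x i)))"
    using pos nz finite_V by (intro sum.cong refl ln_prod) auto
  also have "\<dots> = (\<Sum>v\<in>V. \<Sum>i\<in>{1..n}. ln (h v (x i)))" by (rule sum.swap)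
  also have "\<dots> = (\<Sum>v\<in>V. loglik n v (nbrs V G v))"
  proof (intro sum.cong refl)
    fix v
    have "{i\<in>{1..n}. x i \<in> \<Omega>} = {1..n}" using x by blast
    then have "(\<Sum>i\<in>{1..n}. ln (h v (x i))) = (\<Sum>y\<in>\<Omega>. real (card {i\<in>{1..n}. x i = y}) * ln (h v y))"
      using sum_over_sample[of n x \<Omega>, OF x subset_refl, where f = "\<lambda>y. ln (h v y)"] by simp
    then show "(\<Sum>i\<in>{1..n}. ln (h v (x i))) = loglik n v (nbrs V G v)"
      using c by (simp add: loglik_def h_def)
  qed
  finally show ?thesis
    by (simp add: penalized_score_def score_def sum_subtractf sum_distrib_left)
qed

end

text \<open>The pathwise part. There are finitely many pairs of a site and a candidate neighborhood,
  so eventually the basic neighborhood wins at all sites simultaneously; as the dependency graph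
  realizes these winners, any other graph has a strictly smaller total.\<close>

lemma (in random_configuration) graph_estimate_eventually:
  assumes "markov_intersection_property V A \<pi>" "2 \<le> card A" "0 < \<kappa>"
    and x: "\<And>i. 1 \<le> i \<Longrightarrow> x i \<in> \<Omega>"
    and support: "\<And>i. 1 \<le> i \<Longrightarrow> p (x i) \<noteq> 0"
    and limit: "\<And>y. y \<in> \<Omega> \<Longrightarrow> (\<lambda>n. (real (card {i\<in>{1..n}. x i = y}) - real n * p y)\<^sup>2
      / (real n * ln (real n))) \<longlonglongrightarrow> 0"
    and est: "\<And>n. 1 \<le> n \<Longrightarrow> is_graph_estimate V A (\<kappa> * ln (real n)) x n (Ghat n)"
  shows "\<forall>\<^sub>F n in sequentially. Ghat n = dependency_graph V A \<pi>"
proof -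
  let ?G = "dependency_graph V A \<pi>" and ?ne = "basic_neighborhood V A \<pi>"
  define c where "c n y = real (card {i\<in>{1..n}. x i = y})" for n y
  interpret converging_counts V A p c
  proof
    show "sum (c n) \<Omega> = real n" for n
    proof -
      have "{i\<in>{1..n}. x i \<in> \<Omega>} = {1..n}" using x by (metis (no_types, lifting) Collect_cong Collect_mem_eq atLeastAtMost_iff)
      then show ?thesis using sum_over_sample[of n x \<Omega>, OF _ subset_refl, where f = "\<lambda>_. 1"] x by (simp add: c_def)
    qed
    show "c n y = 0" if "y \<in> \<Omega>" "p y = 0" for n y
    proof -
      have "{i\<in>{1..n}. x i = y} = {}" using support that by auto
      then show ?thesis unfolding c_def by (simp only: card.empty of_nat_0)
    qed
  qed (use limit in \<open>auto simp: c_def\<close>)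
  have "\<forall>\<^sub>F n in sequentially. score \<kappa> n v W < score \<kappa> n v (?ne v)"
    if v: "v \<in> V" and W: "W \<subseteq> V - {v}" "W \<noteq> ?ne v" for v W
  proof (cases "screens v W")
    case True
    then have "?ne v \<subset> W" using W(2) basic_neighborhood_le[OF assms(1) v] by blast
    then show ?thesis
      by (intro score_overfit basic_neighborhood_screens assms True v)
  next
    case False
    then show ?thesis by (intro score_underfit basic_neighborhood_screens assms v W)
  qed
  then have "\<forall>\<^sub>F n in sequentially. \<forall>(v, W)\<in>(SIGMA v:V. Pow (V - {v}) - {?ne v}). score \<kappa> n v W < score \<kappa> n v (?ne v)"
    using finite_V by (intro eventually_ball_finite finite_SigmaI) auto
  with eventually_ge_at_top[of 1] show ?thesis
  proof eventually_elim
    case (elim n)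
    have better: "score \<kappa> n v W < score \<kappa> n v (?ne v)" if "v \<in> V" "W \<subseteq> V - {v}" "W \<noteq> ?ne v" for v W
      using elim(2) that by auto
    have pen: "penalized_score V A (\<kappa> * ln (real n)) x n H = (\<Sum>v\<in>V. score \<kappa> n v (nbrs V H v))" for H
      using x elim(1) by (intro penalized_score_eq) (auto simp: c_def)
    have Ghat: "simple_graph V (Ghat n)"
      and max: "\<And>H. simple_graph V H \<Longrightarrow> \<not> penalized_score V A (\<kappa> * ln (real n)) x n (Ghat n) < penalized_score V A (\<kappa> * ln (real n)) x n H"
      using est[OF elim(1)] by (auto simp: is_graph_estimate_def is_arg_max_def)
    show "Ghat n = ?G"
    proof (rule ccontr)
      assume "Ghat n \<noteq> ?G"
      then obtain w where w: "w \<in> V" "nbrs V (Ghat n) w \<noteq> nbrs V ?G w"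
        using simple_graph_eqI[OF Ghat simple_graph_dependency_graph[OF assms(1)]] by blast
      have "(\<Sum>v\<in>V. score \<kappa> n v (nbrs V (Ghat n) v)) < (\<Sum>v\<in>V. score \<kappa> n v (nbrs V ?G v))"
      proof (rule sum_strict_mono_ex1[OF finite_V])
        show "\<forall>v\<in>V. score \<kappa> n v (nbrs V (Ghat n) v) \<le> score \<kappa> n v (nbrs V ?G v)"
          using better nbrs_subset[OF Ghat] nbrs_dependency_graph[OF assms(1)] by (metis less_imp_le order_refl)
        show "\<exists>v\<in>V. score \<kappa> n v (nbrs V (Ghat n) v) < score \<kappa> n v (nbrs V ?G v)"
          using better[OF w(1) nbrs_subset[OF Ghat]] w nbrs_dependency_graph[OF assms(1) w(1)] by metis
      qed
      then show False using max[OF simple_graph_dependency_graph[OF assms(1)]] by (simp add: pen)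
    qed
  qed
qed

text \<open>\<open>Ghat\<close> is any choice of maximizers, so ties are covered. For a one-letter
  alphabet all graphs have the same score, which \<open>2 \<le> card A\<close> rules out.\<close>

theorem theorem4:
  fixes M :: "'w measure"
    and A :: "'a set"
    and d :: nat
    and V :: "nat set"
    and X :: "nat \<Rightarrow> 'w \<Rightarrow> nat \<Rightarrow> 'a"
    and \<pi> :: "(nat \<Rightarrow> 'a) measure"
    and \<psi> :: "nat \<Rightarrow> real"
    and \<epsilon> c :: real
    and Ghat :: "nat \<Rightarrow> 'w \<Rightarrow> (nat \<times> nat) set"
  assumes "prob_space M"
    and "finite A" and "2 \<le> card A"
    and "1 \<le> d" and "V = {1..d}"
    and "\<And>i. 1 \<le> i \<Longrightarrow> X i \<in> measurable M (config_space V A)"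
    and "stationary_process M (V \<rightarrow>\<^sub>E A) X"
    and "\<pi> = distr M (config_space V A) (X 1)"
    and "markov_intersection_property V A \<pi>"
    and "mixing_with_rate M (V \<rightarrow>\<^sub>E A) X \<psi>"
    and "0 < \<epsilon>" and "\<psi> \<in> O(\<lambda>l. 1 / real l powr (1 + \<epsilon>))"
    and "0 < c"
    and "\<And>n \<omega>. 1 \<le> n \<Longrightarrow> \<omega> \<in> space M \<Longrightarrow>
           is_graph_estimate V A (c * ln (real n)) (\<lambda>i. X i \<omega>) n (Ghat n \<omega>)"
  shows "AE \<omega> in M. \<forall>\<^sub>F n in sequentially. Ghat n \<omega> = dependency_graph V A \<pi>"
proof -
  interpret prob_space M by fact
  define S where "S = V \<rightarrow>\<^sub>E A"
  have finS: "finite S" unfolding S_def using assms by (intro finite_PiE) auto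
  have X: "X i \<in> measurable M (count_space S)" if "1 \<le> i" for i
    using assms(6)[OF that] by (simp add: S_def)
  interpret random_configuration V A \<pi>
  proof (intro random_configuration.intro finite_configurations.intro random_configuration_axioms.intro)
    show "finite V" "finite A" using assms by auto
    show "prob_space \<pi>" unfolding assms(8) by (intro prob_space_distr assms(6)) simp
    show "sets \<pi> = Pow (V \<rightarrow>\<^sub>E A)" unfolding assms(8) by simp
  qed
  have p: "p y = \<P>(\<omega> in M. X 1 \<omega> = y)" if "y \<in> S" for y
  proof -
    have "p y = prob (X 1 -` {y} \<inter> space M)"
      unfolding p_def unfolding assms(8) using that by (intro measure_distr assms(6)) (auto simp: S_def)
    also have "X 1 -` {y} \<inter> space M = {\<omega> \<in> space M. X 1 \<omega> = y}" by auto
    finally show ?thesis .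
  qed
  have limit: "AE \<omega> in M. \<forall>y\<in>S. (\<lambda>n. (real (card {i\<in>{1..n}. X i \<omega> = y}) - real n * p y)\<^sup>2
      / (real n * ln (real n))) \<longlonglongrightarrow> 0"
  proof (rule AE_finite_allI[OF finS])
    fix y assume y: "y \<in> S"
    show "AE \<omega> in M. (\<lambda>n. (real (card {i\<in>{1..n}. X i \<omega> = y}) - real n * p y)\<^sup>2
        / (real n * ln (real n))) \<longlonglongrightarrow> 0"
      unfolding p[OF y]
      using assms(1) finS X assms(7,10)[folded S_def] assms(11,12) y by (rule AE_count_limit)
  qed
  \<comment> \<open>By stationarity a configuration of mass zero is null at each time, and there are
    finitely many configurations and countably many times. This supplies the support condition of
    the pathwise lemma.\<close>
  have support: "AE \<omega> in M. \<forall>i. 1 \<le> i \<longrightarrow> p (X i \<omega>) \<noteq> 0"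
    unfolding AE_all_countable
  proof
    fix i
    have "AE \<omega> in M. \<forall>y\<in>{y \<in> S. p y = 0}. 1 \<le> i \<longrightarrow> X i \<omega> \<noteq> y"
    proof (rule AE_finite_allI)
      fix y assume "y \<in> {y \<in> S. p y = 0}"
      then have y: "y \<in> S" "p y = 0" by auto
      show "AE \<omega> in M. 1 \<le> i \<longrightarrow> X i \<omega> \<noteq> y"
      proof (cases "1 \<le> i")
        case True
        have "prob {\<omega> \<in> space M. X i \<omega> = y} = 0"
          using stationary_marginal[OF assms(7)[folded S_def] True y(1)] y(2) p[OF y(1)] by simp
        then show ?thesis
          using sets_eq_of_count_space[OF X[OF True]] by (simp add: prob_eq_0)
      qed simp
    qed (use finS in auto)
    then show "AE \<omega> in M. 1 \<le> i \<longrightarrow> p (X i \<omega>) \<noteq> 0"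
      using AE_space
    proof eventually_elim
      case (elim \<omega>)
      show ?case
      proof
        assume "1 \<le> i"
        then have "X i \<omega> \<in> S" using measurable_space[OF X elim(2)] by simp
        then show "p (X i \<omega>) \<noteq> 0" using elim(1) \<open>1 \<le> i\<close> by auto
      qed
    qed
  qed
  from limit support AE_space show ?thesis
  proof eventually_elim
    case (elim \<omega>)
    show ?case
    proof (rule graph_estimate_eventually[where x = "\<lambda>i. X i \<omega>" and \<kappa> = c and Ghat = "\<lambda>n. Ghat n \<omega>"])
      show "X i \<omega> \<in> V \<rightarrow>\<^sub>E A" if "1 \<le> i" for i
        using measurable_space[OF X[OF that] elim(3)] by (simp add: S_def)
    qed (use assms elim in \<open>auto simp: S_def\<close>)
  qed
qed

end
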